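(* Let $f\in V_\beta^\infty(\varphi)$ and let $p\in\mathbb{R}$ be such that $f(p)\neq 0$. Then $f$ is uniquely determined, up to a global unimodular constant, by the phaseless measurements $\{|S_{\check\varphi}^{\mathbf A}f(\tfrac{\beta n}{2},t)| : n\in\mathbb{Z},\ t\in\mathbb{R}\}$; that is, if $g\in V_\beta^\infty(\varphi)$ satisfies $|S_{\check\varphi}^{\mathbf A}g(\tfrac{\beta n}{2},t)|=|S_{\check\varphi}^{\mathbf A}f(\tfrac{\beta n}{2},t)|$ for all $n\in\mathbb{Z}$, $t\in\mathbb{R}$, then $g=\tau' f$ for some $\tau'\in\mathbb{C}$ with $|\tau'|=1$. Moreover, there exists $\tau\in\mathbb{C}$ with $|\tau|=1$ such that for all $\xi\in\mathbb{R}$ $$f(p+\xi)=\tau\,|f(p)|^{-1}\sum_{n\in\mathbb{Z}}e^{-\frac{\pi i a\beta n\xi}{b}}\left(\int_{\mathbb{R}}\bigl|S_{\check\varphi}^{\mathbf A}f(\tfrac{\beta n}{2},t)\bigr|^2e^{\frac{2\pi i\xi t}{b}}\,dt\right)T_{\frac{\beta}{2}n}\widetilde{\varphi_\xi}(p+\xi),$$ where $$|f(p)|=\left(\sum_{n\in\mathbb{Z}}\left(\int_{\mathbb{R}}\bigl|S_{\check\varphi}^{\mathbf A}f(\tfrac{\beta n}{2},t)\bigr|^2\,dt\right)T_{\frac{\beta}{2}n}\widetilde{\varphi_0}(p)\right)^{1/2}.$$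
   Context: Fix $\sigma>0$, $\beta>0$ and a real matrix $\mathbf A=\begin{pmatrix}a&b\\c&d\end{pmatrix}$ with $ad-bc=1$ and $b>0$. Gaussian: $\varphi(t)=e^{-t^2/(2\sigma^2)}$. Gaussian shift-invariant space: $V_\beta^\infty(\varphi)=\{\sum_{k\in\mathbb{Z}}c_k\varphi(\cdot-\beta k):(c_k)\in\ell^\infty(\mathbb{Z})\}$ with complex coefficients. Short-time linear canonical transform (STLCT) with window $\omega$: $S_\omega^{\mathbf A}f(x,\xi)=\int_{\mathbb{R}}f(t)\overline{\omega(t-x)}K_{\mathbf A}(\xi,t)\,dt$, where $K_{\mathbf A}(\xi,t)=\frac{1}{\sqrt{ib}}e^{\frac{i\pi}{b}(at^2-2\xi t+d\xi^2)}$. The window used is the chirp-modulated Gaussian $\check\varphi(t)=e^{i\pi\frac{a}{b}t^2}\varphi(t)$. Translation: $T_xf(t)=f(t-x)$. Fourier transform: $\mathcal{F}f(\xi)=\int_{\mathbb{R}}f(t)e^{-2\pi i\xi t}dt$. For $\xi\in\mathbb{R}$ put $\varphi_\xi(t)=\varphi(t-\xi)\overline{\varphi(t)}$. The system $(\varphi_\xi(\cdot-\frac{\beta}{2}n))_{n\in\mathbb{Z}}$ is a Riesz basis of its closed span in $L^2(\mathbb{R})$, and $\widetilde{\varphi_\xi}$ denotes its dual generator (biorthogonal: $\langle T_{\frac{\beta}{2}n}\widetilde{\varphi_\xi},T_{\frac{\beta}{2}k}\varphi_\xi\rangle=\delta_{n,k}$), explicitly $\widetilde{\varphi_\xi}=\sqrt2\,e^{\frac{\xi^2}{4\sigma^2}}\,T_{\frac{\xi}{2}}\mathcal{F}^{-1}\Lambda$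 with $\Lambda(t)=\dfrac{e^{-\pi^2\sigma^2t^2}}{\vartheta_3(\frac{\beta}{2}\pi t,\,e^{-\beta^2/(8\sigma^2)})}$ and $\vartheta_3(z,q)=\sum_{n\in\mathbb{Z}}q^{n^2}e^{2niz}$. *)

theory Defs
  imports "HOL-Analysis.Analysis"
begin

definition translate :: "real \<Rightarrow> (real \<Rightarrow> complex) \<Rightarrow> real \<Rightarrow> complex" where
  "translate x f t = f (t - x)"

definition gaussian :: "real \<Rightarrow> real \<Rightarrow> complex" where
  "gaussian \<sigma> t = complex_of_real (exp (- t\<^sup>2 / (2 * \<sigma>\<^sup>2)))"

definition shift_inv_space :: "real \<Rightarrow> (real \<Rightarrow> complex) \<Rightarrow> (real \<Rightarrow> complex) set" where
  "shift_inv_space \<beta> \<phi> =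
     {f. \<exists>c :: int \<Rightarrow> complex. bounded (range c) \<and>
         (\<forall>t. ((\<lambda>k. c k * translate (\<beta> * of_int k) \<phi> t) has_sum f t) UNIV)}"

text \<open>
  For a matrix \<open>A\<close> with rows \<open>(a, b)\<close> and \<open>(c, d)\<close>; the square root of \<open>\<i> b\<close> is the
  principal branch.
\<close>
definition lct_kernel :: "real^2^2 \<Rightarrow> real \<Rightarrow> real \<Rightarrow> complex" where
  "lct_kernel A \<xi> t =
     1 / csqrt (\<i> * complex_of_real (A $ 1 $ 2)) *
     exp (\<i> * complex_of_real (pi / A $ 1 $ 2 *
       (A $ 1 $ 1 * t\<^sup>2 - 2 * \<xi> * t + A $ 2 $ 2 * \<xi>\<^sup>2)))"

definition stlct ::
  "real^2^2 \<Rightarrow> (real \<Rightarrow> complex) \<Rightarrow> (real \<Rightarrow> complex) \<Rightarrow> real \<Rightarrow> real \<Rightarrow> complex" where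
  "stlct A \<omega> f x \<xi> = (LINT t|lborel. f t * cnj (\<omega> (t - x)) * lct_kernel A \<xi> t)"

definition chirp_gaussian :: "real^2^2 \<Rightarrow> real \<Rightarrow> real \<Rightarrow> complex" where
  "chirp_gaussian A \<sigma> t =
     exp (\<i> * complex_of_real (pi * (A $ 1 $ 1 / A $ 1 $ 2) * t\<^sup>2)) * gaussian \<sigma> t"

definition theta3 :: "complex \<Rightarrow> complex \<Rightarrow> complex" where
  "theta3 z q = (\<Sum>\<^sub>\<infinity>n::int. q powi (n\<^sup>2) * exp (2 * of_int n * \<i> * z))"

text \<open>
  The inverse of the Fourier transform with kernel \<open>exp (- 2 \<pi> \<i> \<xi> t)\<close>, given by the inversion
  integral; it is only applied to an integrable function below.
\<close>
definition inv_fourier :: "(real \<Rightarrow> complex) \<Rightarrow> real \<Rightarrow> complex" where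
  "inv_fourier h x = (LINT t|lborel. h t * exp (2 * pi * \<i> * complex_of_real (x * t)))"

definition dual_symbol :: "real \<Rightarrow> real \<Rightarrow> real \<Rightarrow> complex" where
  "dual_symbol \<sigma> \<beta> t =
     complex_of_real (exp (- pi\<^sup>2 * \<sigma>\<^sup>2 * t\<^sup>2)) /
     theta3 (complex_of_real (\<beta> / 2 * pi * t)) (complex_of_real (exp (- \<beta>\<^sup>2 / (8 * \<sigma>\<^sup>2))))"

text \<open>
  The dual generator of the Riesz sequence of \<open>\<beta>/2\<close>-shifts of
  \<open>\<phi>\<^sub>\<xi>(t) = \<phi>(t - \<xi>) cnj (\<phi>(t))\<close>, where \<open>\<phi> = gaussian \<sigma>\<close>.  As an element of \<open>L\<^sup>2\<close> it is only
  determined almost everywhere; since point values are needed, it is fixed by its explicit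
  (continuous) formula.
\<close>
definition dual_generator :: "real \<Rightarrow> real \<Rightarrow> real \<Rightarrow> real \<Rightarrow> complex" where
  "dual_generator \<sigma> \<beta> \<xi> t =
     complex_of_real (sqrt 2 * exp (\<xi>\<^sup>2 / (4 * \<sigma>\<^sup>2))) *
     translate (\<xi> / 2) (inv_fourier (dual_symbol \<sigma> \<beta>)) t"

end

theory Submission
  imports Defs "HOL-Probability.Characteristic_Functions"
begin

text \<open>
  Expanding \<open>f\<close> in its coefficients \<open>c\<close>, every measurement \<open>|S f(\<beta> n / 2, \<cdot>)|\<^sup>2\<close> is an absolutely convergent
  double sum of Gaussians times characters.  Its Fourier integral at \<open>\<xi> / b\<close> is, up to a phase, the
  \<open>n\<close>-th inner product of \<open>f\<close> times the conjugate of \<open>f(\<cdot> - \<xi>)\<close> with the shifts of \<open>\<phi>\<^sub>\<xi>\<close>, i.e. the convolution of a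
  sequence with \<open>q\<^bsup>n\<^sup>2\<^esup>\<close>, \<open>q = exp (- \<beta>\<^sup>2 / (8 \<sigma>\<^sup>2))\<close>.  An explicit absolutely summable inverse of this convolution
  gives the Fourier series of \<open>1 / \<theta>\<^sub>3\<close>, hence the decay of the dual generator and the
  identity \<open>f(v) cnj (f(v - \<xi>)) = \<Sum>\<^sub>n \<dots>\<close>, from which everything follows with \<open>v = p + \<xi>\<close>.
\<close>

subsection \<open>Unconditional sums over the integers\<close>

text \<open>The coefficients \<open>c\<close> are only bounded, so f need not lie in L^2, and
  neither need the product of f with the conjugate of its translate. A Riesz basis expansion in L^2
  therefore does not give the point values; the reconstruction is proved pointwise, by exchanging
  unordered sums. This requires the samples of the dual generator on the \<beta>/2-lattice to be
  absolutely summable, hence an l^1 inverse of the convolution with q^(n^2). The half lattice comes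
  from (n/2 - k)^2 + (n/2 - l)^2 = ((k - l)^2 + (n - (k + l))^2) / 2: a pair (k, l) of coefficients
  sees the sample point only through n - (k + l), and the factor \<beta>^2 / (4 \<sigma>^2) in the
  exponent becomes \<eta> = \<beta>^2 / (8 \<sigma>^2). The inverse is found up to the scalar
  \<open>dual_norm\<close>, and the delicate point is that this scalar is not 0. It is a positive
  number times \<theta>_4(q), and \<theta>_4(q) \<noteq> 0 is carried over from small q, where the
  term n = 0 dominates, by repeatedly squaring q.\<close>

lemma has_sum_swap_iff:
  fixes f :: "'a \<Rightarrow> 'b \<Rightarrow> 'c :: banach"
  assumes "(\<lambda>(x, y). norm (f x y)) summable_on UNIV"
    and "\<And>x. (f x has_sum r x) UNIV" and "\<And>y. ((\<lambda>x. f x y) has_sum c y) UNIV"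
  shows "(r has_sum S) UNIV \<longleftrightarrow> (c has_sum S) UNIV"
proof -
  have "(\<lambda>(x, y). f x y) summable_on UNIV \<times> UNIV"
    using assms(1) abs_summable_summable[of "\<lambda>(x, y). f x y" UNIV] by (simp add: case_prod_unfold)
  then obtain T where T: "((\<lambda>(x, y). f x y) has_sum T) (UNIV \<times> UNIV)"
    by (auto simp: summable_on_def)
  have r: "(r has_sum T) UNIV"
    using has_sum_SigmaD[OF T, of r] assms(2) by simp
  have "((\<lambda>(y, x). f x y) has_sum T) (UNIV \<times> UNIV)"
    using T by (subst (asm) has_sum_swap) (simp add: case_prod_unfold)
  from has_sum_SigmaD[OF this, of c] assms(3) have "(c has_sum T) UNIV" by simp
  with r show ?thesis by (metis has_sum_unique)
qed

lemma summable_on_norm_product: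
  fixes f :: "'a \<Rightarrow> 'c :: real_normed_div_algebra" and g :: "'b \<Rightarrow> 'c"
  assumes "(\<lambda>x. norm (f x)) summable_on UNIV" "(\<lambda>x. norm (g x)) summable_on UNIV"
  shows "(\<lambda>(x, y). norm (f x * g y)) summable_on UNIV"
proof -
  have "(\<lambda>(x, y). norm (f x * g y)) summable_on UNIV \<times> UNIV"
  proof (rule summable_on_SigmaI)
    show "((\<lambda>y. case (x, y) of (x, y) \<Rightarrow> norm (f x * g y)) has_sum
        norm (f x) * (\<Sum>\<^sub>\<infinity>y. norm (g y))) UNIV" for x
      using has_sum_cmult_right[OF has_sum_infsum[OF assms(2)], of "norm (f x)"]
      by (simp add: norm_mult)
    show "(\<lambda>x. norm (f x) * (\<Sum>\<^sub>\<infinity>y. norm (g y))) summable_on UNIV"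
      using assms(1) by (rule summable_on_cmult_left)
  qed auto
  then show ?thesis by simp
qed

lemma has_sum_product_UNIV:
  fixes f :: "'a \<Rightarrow> 'c :: {banach, real_normed_div_algebra}" and g :: "'b \<Rightarrow> 'c"
  assumes "(\<lambda>x. norm (f x)) summable_on UNIV" "(\<lambda>x. norm (g x)) summable_on UNIV"
    and "(f has_sum a) UNIV" "(g has_sum b) UNIV"
  shows "((\<lambda>(x, y). f x * g y) has_sum a * b) UNIV"
proof -
  have "((\<lambda>(x, y). f x * g y) has_sum a * b) (UNIV \<times> UNIV)"
  proof (rule has_sum_SigmaI)
    show "((\<lambda>y. case (x, y) of (x, y) \<Rightarrow> f x * g y) has_sum f x * b) UNIV" for x
      using has_sum_cmult_right[OF assms(4)] by simp
    show "((\<lambda>x. f x * b) has_sum a * b) UNIV"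
      using assms(3) by (rule has_sum_cmult_left)
    show "(\<lambda>(x, y). f x * g y) summable_on UNIV \<times> UNIV"
      using summable_on_norm_product[OF assms(1,2)] abs_summable_summable[of "\<lambda>(x, y). f x * g y" "UNIV \<times> UNIV"]
      by (simp add: case_prod_unfold)
  qed
  then show ?thesis by simp
qed

lemma has_sum_abs_power_int:
  fixes r :: real
  assumes "0 \<le> r" "r < 1"
  shows "((\<lambda>n::int. r ^ nat \<bar>n\<bar>) has_sum (1 + r) / (1 - r)) UNIV"
proof -
  have g: "((\<lambda>k. r ^ k) has_sum 1 / (1 - r)) UNIV"
    using geometric_sums[of r] assms by (intro norm_summable_imp_has_sum) (auto simp: summable_geometric)
  have "((\<lambda>n::int. r ^ nat \<bar>n\<bar>) has_sum 1 / (1 - r)) {0..}"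
    using g by (subst has_sum_reindex_bij_witness[of _ int nat UNIV "\<lambda>k. r ^ k"]) auto
  moreover have "((\<lambda>n::int. r ^ nat \<bar>n\<bar>) has_sum r * (1 / (1 - r))) {..<0}"
    using has_sum_cmult_right[OF g, of r]
    by (subst has_sum_reindex_bij_witness[of _ "\<lambda>k. - int k - 1" "\<lambda>n. nat (- n - 1)" UNIV "\<lambda>k. r * r ^ k"])
      (auto simp flip: power_Suc intro!: arg_cong[of _ _ "power r"])
  ultimately have "((\<lambda>n::int. r ^ nat \<bar>n\<bar>) has_sum 1 / (1 - r) + r * (1 / (1 - r))) ({0..} \<union> {..<0})"
    by (rule has_sum_Un_disjoint) auto
  moreover have "{0..} \<union> {..<0} = (UNIV :: int set)" by auto
  ultimately show ?thesis using assms by (simp add: field_simps)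
qed

lemma summable_on_exp_abs_int:
  assumes "\<kappa> > 0"
  shows "(\<lambda>n::int. exp (- \<kappa> * \<bar>of_int n\<bar>) :: real) summable_on UNIV"
proof -
  have "exp (- \<kappa>) ^ nat \<bar>n\<bar> = exp (- \<kappa> * \<bar>of_int n\<bar>)" for n :: int
    by (simp add: exp_of_nat_mult[symmetric] mult.commute)
  then show ?thesis
    using has_sum_abs_power_int[of "exp (- \<kappa>)"] assms by (auto simp: summable_on_def)
qed

lemma of_int_abs_le_square: "\<bar>of_int n\<bar> \<le> (of_int n :: real)\<^sup>2"
proof -
  have "\<bar>n\<bar> \<le> \<bar>n\<bar>\<^sup>2"
    using self_le_power[of "\<bar>n\<bar>" 2] by (cases "n = 0") auto
  then have "real_of_int \<bar>n\<bar> \<le> real_of_int (n\<^sup>2)"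
    by (simp only: of_int_le_iff power2_abs)
  then show ?thesis by simp
qed

lemma summable_on_gauss_int:
  assumes "\<kappa> > 0"
  shows "(\<lambda>n::int. exp (- \<kappa> * (s - of_int n)\<^sup>2) :: real) summable_on UNIV"
proof (rule summable_on_comparison_test)
  show "(\<lambda>n::int. exp (\<kappa> * s\<^sup>2) * exp (- (\<kappa> / 2) * \<bar>of_int n\<bar>)) summable_on UNIV"
    using summable_on_exp_abs_int[of "\<kappa> / 2"] assms by (intro summable_on_cmult_right) auto
  fix n :: int
  \<comment> \<open>This square gives (s - n)^2 \<ge> n^2 / 2 - s^2: the shift is absorbed into a
    constant at the cost of half the exponent.\<close>
  have "0 \<le> (of_int n - 2 * s)\<^sup>2" by simp
  then have "of_int n ^ 2 / 2 - s\<^sup>2 \<le> (s - of_int n)\<^sup>2"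
    by (simp add: power2_eq_square algebra_simps)
  with of_int_abs_le_square[of n] have "\<bar>of_int n\<bar> / 2 - s\<^sup>2 \<le> (s - of_int n)\<^sup>2" by simp
  then have "\<kappa> * (\<bar>of_int n\<bar> / 2 - s\<^sup>2) \<le> \<kappa> * (s - of_int n)\<^sup>2"
    using assms by (intro mult_left_mono) auto
  then show "exp (- \<kappa> * (s - of_int n)\<^sup>2) \<le> exp (\<kappa> * s\<^sup>2) * exp (- (\<kappa> / 2) * \<bar>of_int n\<bar>)"
    by (simp add: exp_add[symmetric] algebra_simps)
qed auto

lemma summable_on_gauss_int_0:
  assumes "\<kappa> > 0"
  shows "(\<lambda>n::int. exp (- \<kappa> * (of_int n)\<^sup>2) :: real) summable_on UNIV"
  using summable_on_gauss_int[OF assms, of 0] by simp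

subsection \<open>Inverting the Gaussian convolution\<close>

text \<open>A partial theta series in q = exp (- \<eta>): the decaying solution of g(x) + g(x + 1) =
  q^(x (x + 1)), obtained by iterating that equation upwards. At integers it is even, because j (j +
  1) is invariant under j -> -1 - j while (-1)^j changes sign; this is why \<open>dual_coeff\<close>
  can use the argument |n|.\<close>

definition alt_tail :: "real \<Rightarrow> real \<Rightarrow> real" where
  "alt_tail \<eta> x = (\<Sum>k. (-1) ^ k * exp (- \<eta> * ((x + real k) * (x + real k + 1))))"

text \<open>Up to the constant \<open>dual_norm \<eta>\<close> below, these are the Fourier coefficients of \<open>1 / \<theta>\<^sub>3\<close>. With
  \<open>q = exp (- \<eta>)\<close> they are chosen so that \<open>g n = q\<^bsup>n\<^sup>2\<^esup> dual_coeff \<eta> n\<close> satisfies \<open>g n - g (n + 1) = (-1)\<^sup>n q\<^bsup>n (n + 1)\<^esup>\<close>,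
  which makes its
  two-sided generating function vanish at \<open>q\<^bsup>2m\<^esup>\<close> for \<open>m \<noteq> 0\<close>.\<close>

definition dual_coeff :: "real \<Rightarrow> int \<Rightarrow> real" where
  "dual_coeff \<eta> n = (-1) powi n * exp (\<eta> * (of_int n)\<^sup>2) * alt_tail \<eta> \<bar>of_int n\<bar>"

lemma alt_tail_term_le:
  assumes "\<eta> > 0" "x \<ge> 0"
  shows "exp (- \<eta> * ((x + real k) * (x + real k + 1))) \<le> exp (- \<eta> * (x\<^sup>2 + x)) * exp (- \<eta>) ^ k"
proof -
  have "(x\<^sup>2 + x) + real k \<le> (x + real k) * (x + real k + 1)"
    using assms by (simp add: power2_eq_square algebra_simps)
  then have "\<eta> * ((x\<^sup>2 + x) + real k) \<le> \<eta> * ((x + real k) * (x + real k + 1))"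
    using assms by (intro mult_left_mono) auto
  then show ?thesis
    by (simp add: exp_of_nat_mult[symmetric] exp_add[symmetric] algebra_simps)
qed

lemma summable_alt_tail:
  assumes "\<eta> > 0" "x \<ge> 0"
  shows "summable (\<lambda>k. exp (- \<eta> * ((x + real k) * (x + real k + 1))))"
proof (rule summable_comparison_test)
  show "\<exists>N. \<forall>k\<ge>N. norm (exp (- \<eta> * ((x + real k) * (x + real k + 1)))) \<le> exp (- \<eta> * (x\<^sup>2 + x)) * exp (- \<eta>) ^ k"
    using alt_tail_term_le[OF assms] by auto
  show "summable (\<lambda>k. exp (- \<eta> * (x\<^sup>2 + x)) * exp (- \<eta>) ^ k)"
    using assms by (intro summable_mult summable_geometric) auto
qed

text \<open>The first term dominates a geometric series. Its factor exp (- \<eta> x) beyond q^(x^2)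
  is what survives when \<open>dual_coeff\<close> multiplies by q^(-n^2), and it makes the inverse
  sequence decay geometrically.\<close>

lemma alt_tail_bound:
  assumes "\<eta> > 0" "x \<ge> 0"
  shows "\<bar>alt_tail \<eta> x\<bar> \<le> exp (- \<eta> * (x\<^sup>2 + x)) / (1 - exp (- \<eta>))"
proof -
  have "norm (alt_tail \<eta> x) \<le> (\<Sum>k. norm ((-1) ^ k * exp (- \<eta> * ((x + real k) * (x + real k + 1)))))"
    unfolding alt_tail_def using summable_alt_tail[OF assms] by (intro summable_norm) (simp add: abs_mult power_abs)
  also have "\<dots> \<le> (\<Sum>k. exp (- \<eta> * (x\<^sup>2 + x)) * exp (- \<eta>) ^ k)"
    using summable_alt_tail[OF assms] alt_tail_term_le[OF assms] assms
    by (intro suminf_le summable_mult summable_geometric) (auto simp: abs_mult power_abs)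
  also have "\<dots> = exp (- \<eta> * (x\<^sup>2 + x)) / (1 - exp (- \<eta>))"
    using assms by (subst suminf_mult) (auto simp: suminf_geometric summable_geometric)
  finally show ?thesis by simp
qed

lemma alt_tail_rec:
  assumes "\<eta> > 0" "x \<ge> 0"
  shows "alt_tail \<eta> x + alt_tail \<eta> (x + 1) = exp (- \<eta> * (x * (x + 1)))"
proof -
  let ?f = "\<lambda>k. (-1) ^ k * exp (- \<eta> * ((x + real k) * (x + real k + 1)))"
  have s: "summable ?f"
    using summable_alt_tail[OF assms]
    by (intro summable_norm_cancel[of ?f]) (simp add: abs_mult power_abs)
  have "(\<Sum>k. ?f (Suc k)) = (\<Sum>k. - ((-1) ^ k * exp (- \<eta> * ((x + 1 + real k) * (x + 1 + real k + 1)))))"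
    by (intro suminf_cong) (simp add: algebra_simps)
  also have "\<dots> = - alt_tail \<eta> (x + 1)"
    unfolding alt_tail_def using summable_alt_tail[of \<eta> "x + 1"] assms
    by (intro suminf_minus summable_norm_cancel[of "\<lambda>k. (-1) ^ k * exp (- \<eta> * ((x + 1 + real k) * (x + 1 + real k + 1)))"])
      (simp add: abs_mult power_abs)
  finally show ?thesis
    using suminf_split_head[OF s] by (simp add: alt_tail_def)
qed

text \<open>The terms decrease strictly, so the alternating series is bounded below by its first two
  terms. Positivity is what later keeps the coefficient series away from 0 at the character
  (-1)^n.\<close>

lemma alt_tail_pos:
  assumes "\<eta> > 0" "x \<ge> 0"
  shows "alt_tail \<eta> x > 0"
proof -
  let ?f = "\<lambda>k. exp (- \<eta> * ((x + real k) * (x + real k + 1)))"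
  have mono: "?f (Suc k) < ?f k" for k
    using assms by (auto intro!: mult_strict_mono)
  have "(\<Sum>i<2 * 1. (-1) ^ i * ?f i) \<le> (\<Sum>k. (-1) ^ k * ?f k)"
    using summable_LIMSEQ_zero[OF summable_alt_tail[OF assms]] mono
    by (intro summable_Leibniz'(2)) (auto intro: less_imp_le)
  also have "\<dots> = alt_tail \<eta> x" by (simp add: alt_tail_def)
  also have "(\<Sum>i<2 * 1. (-1) ^ i * ?f i) = ?f 0 - ?f (Suc 0)"
    by (simp add: numeral_2_eq_2)
  finally show ?thesis using mono[of 0] by linarith
qed

lemma dual_coeff_bound:
  assumes "\<eta> > 0"
  shows "\<bar>dual_coeff \<eta> n\<bar> \<le> exp (- \<eta> * \<bar>of_int n\<bar>) / (1 - exp (- \<eta>))"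
proof -
  have "\<bar>dual_coeff \<eta> n\<bar> = exp (\<eta> * (of_int n)\<^sup>2) * \<bar>alt_tail \<eta> \<bar>of_int n\<bar>\<bar>"
    by (simp add: dual_coeff_def abs_mult power_int_abs)
  also have "\<dots> \<le> exp (\<eta> * (of_int n)\<^sup>2) * (exp (- \<eta> * (\<bar>of_int n\<bar>\<^sup>2 + \<bar>of_int n\<bar>)) / (1 - exp (- \<eta>)))"
    using alt_tail_bound[OF assms, of "\<bar>of_int n\<bar>"] by (intro mult_left_mono) auto
  also have "\<dots> = exp (- \<eta> * \<bar>of_int n\<bar>) / (1 - exp (- \<eta>))"
    by (simp add: exp_add[symmetric] algebra_simps)
  finally show ?thesis .
qed

lemma dual_coeff_abs_summable:
  assumes "\<eta> > 0"
  shows "(\<lambda>n. norm (dual_coeff \<eta> n)) summable_on UNIV"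
proof (rule summable_on_comparison_test)
  show "(\<lambda>n::int. inverse (1 - exp (- \<eta>)) * exp (- \<eta> * \<bar>of_int n\<bar>)) summable_on UNIV"
    using assms by (intro summable_on_cmult_right summable_on_exp_abs_int)
qed (use dual_coeff_bound[OF assms] in \<open>auto simp: field_simps\<close>)

lemma dual_coeff_rec:
  assumes "\<eta> > 0"
  shows "exp (- \<eta> * (of_int n)\<^sup>2) * dual_coeff \<eta> n
      - exp (- \<eta> * (of_int (n + 1))\<^sup>2) * dual_coeff \<eta> (n + 1)
    = (-1) powi n * exp (- \<eta> * (of_int n * (of_int n + 1)))"
proof -
  have *: "exp (- \<eta> * (of_int n)\<^sup>2) * dual_coeff \<eta> n = (-1) powi n * alt_tail \<eta> \<bar>of_int n\<bar>" for n
  proof -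
    have "exp (- \<eta> * (of_int n)\<^sup>2) * dual_coeff \<eta> n
        = (exp (- \<eta> * (of_int n)\<^sup>2) * exp (\<eta> * (of_int n)\<^sup>2)) * ((-1) powi n * alt_tail \<eta> \<bar>of_int n\<bar>)"
      by (simp only: dual_coeff_def mult_ac)
    then show ?thesis by (simp add: exp_minus)
  qed
  show ?thesis
  proof (cases "n \<ge> 0")
    case True
    then have "alt_tail \<eta> \<bar>of_int n\<bar> + alt_tail \<eta> \<bar>of_int (n + 1)\<bar> = exp (- \<eta> * (of_int n * (of_int n + 1)))"
      using alt_tail_rec[OF assms, of "of_int n"] by simp
    then show ?thesis
      unfolding * by (auto simp: power_int_minus_left)
  next
    case False
    then have abs: "\<bar>of_int n\<bar> = (- of_int n :: real)" "\<bar>of_int (n + 1)\<bar> = (- of_int n - 1 :: real)"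
      by linarith+
    \<comment> \<open>For n < 0 the larger argument is |n| = |n + 1| + 1, so the recurrence is taken
      at x = - n - 1, where again x (x + 1) = n (n + 1).\<close>
    have "alt_tail \<eta> \<bar>of_int n\<bar> + alt_tail \<eta> \<bar>of_int (n + 1)\<bar> = exp (- \<eta> * (of_int n * (of_int n + 1)))"
      using alt_tail_rec[OF assms, of "- of_int n - 1"] False unfolding abs by (simp add: algebra_simps)
    then show ?thesis
      unfolding * by (auto simp: power_int_minus_left)
  qed
qed

lemma has_sum_diff:
  fixes f g :: "'a \<Rightarrow> 'b :: real_normed_field"
  assumes "(f has_sum a) A" "(g has_sum b) A"
  shows "((\<lambda>x. f x - g x) has_sum a - b) A"
  using has_sum_add[OF assms(1) has_sum_uminusI[OF assms(2)]] by simp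

text \<open>The scalar by which the convolution of \<open>dual_coeff\<close> with q^(n^2) differs
  from the unit sequence; dividing by it normalises the inverse.\<close>

definition dual_norm :: "real \<Rightarrow> real" where
  "dual_norm \<eta> = (\<Sum>\<^sub>\<infinity>n. dual_coeff \<eta> n * exp (- \<eta> * (of_int n)\<^sup>2))"

lemma dual_coeff_mult_exp_abs_summable:
  assumes "\<eta> > 0"
  shows "(\<lambda>n. norm (dual_coeff \<eta> n * exp (- \<eta> * (of_int m - of_int n)\<^sup>2))) summable_on UNIV"
  using dual_coeff_abs_summable[OF assms]
proof (rule summable_on_comparison_test)
  fix n
  show "norm (dual_coeff \<eta> n * exp (- \<eta> * (of_int m - of_int n)\<^sup>2)) \<le> norm (dual_coeff \<eta> n)"
    using assms by (auto simp: abs_mult intro!: mult_left_le)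
qed auto

text \<open>For \<open>m \<noteq> 0\<close> the recurrence turns \<open>(1 - q\<^bsup>2m\<^esup>)\<close> times the sum into a series that is odd under the
  reflection \<open>n \<mapsto> 2 m - 1 - n\<close>.\<close>

lemma dual_coeff_convolution:
  assumes "\<eta> > 0"
  shows "((\<lambda>n. dual_coeff \<eta> n * exp (- \<eta> * (of_int m - of_int n)\<^sup>2))
    has_sum (if m = 0 then dual_norm \<eta> else 0)) UNIV"
proof -
  let ?A = "\<lambda>n. dual_coeff \<eta> n * exp (- \<eta> * (of_int m - of_int n)\<^sup>2)"
  have "?A summable_on UNIV"
    using dual_coeff_mult_exp_abs_summable[OF assms] by (rule abs_summable_summable)
  then obtain S where S: "(?A has_sum S) UNIV" by (auto simp: summable_on_def)
  show ?thesis
  proof (cases "m = 0")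
    case True
    with S show ?thesis by (auto simp: dual_norm_def dest: infsumI)
  next
    case False
    \<comment> \<open>The recurrence for q^(n^2) times \<open>dual_coeff\<close>, multiplied by
      q^(m^2 - 2 m n); relative to the convolution term at n + 1 this leaves the factor q^(2
      m).\<close>
    define D where "D n = (-1) powi n * exp (- \<eta> * (of_int n * (of_int n + 1) - 2 * of_int m * of_int n + (of_int m)\<^sup>2))" for n
    have D_eq: "D n = ?A n - exp (- (2 * \<eta> * of_int m)) * ?A (n + 1)" for n
    proof -
      let ?x = "exp (\<eta> * (2 * of_int m * of_int n - (of_int m)\<^sup>2)) :: real"
      have "D n = ((-1) powi n * exp (- \<eta> * (of_int n * (of_int n + 1)))) * ?x"
        by (simp add: D_def mult.assoc exp_add[symmetric] algebra_simps)
      also have "\<dots> = dual_coeff \<eta> n * (exp (- \<eta> * (of_int n)\<^sup>2) * ?x)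
          - dual_coeff \<eta> (n + 1) * (exp (- \<eta> * (of_int (n + 1))\<^sup>2) * ?x)"
        by (subst dual_coeff_rec[OF assms, symmetric]) (simp add: algebra_simps)
      also have "exp (- \<eta> * (of_int n)\<^sup>2) * ?x = exp (- \<eta> * (of_int m - of_int n)\<^sup>2)"
        by (simp add: exp_add[symmetric] power2_eq_square algebra_simps)
      also have "exp (- \<eta> * (of_int (n + 1))\<^sup>2) * ?x
          = exp (- (2 * \<eta> * of_int m)) * exp (- \<eta> * (of_int m - of_int (n + 1))\<^sup>2)"
        by (simp add: exp_add[symmetric] power2_eq_square algebra_simps)
      finally show ?thesis by (simp add: mult_ac)
    qed
    have "((\<lambda>n. ?A (n + 1)) has_sum S) UNIV"
      using S by (subst has_sum_reindex_bij_witness[of _ "\<lambda>n. n - 1" "\<lambda>n. n + 1" UNIV ?A]) auto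
    then have D: "(D has_sum S - exp (- (2 * \<eta> * of_int m)) * S) UNIV"
      unfolding ext[of D, OF D_eq] by (intro has_sum_diff S has_sum_cmult_right)
    have "D (2 * m - 1 - n) = - D n" for n
      by (simp add: D_def power_int_minus_left power2_eq_square algebra_simps)
    moreover have "((\<lambda>n. D (2 * m - 1 - n)) has_sum S - exp (- (2 * \<eta> * of_int m)) * S) UNIV"
      using D by (subst has_sum_reindex_bij_witness[of _ "\<lambda>n. 2 * m - 1 - n" "\<lambda>n. 2 * m - 1 - n" UNIV D]) auto
    ultimately have "((\<lambda>n. - D n) has_sum S - exp (- (2 * \<eta> * of_int m)) * S) UNIV" by simp
    then have "S - exp (- (2 * \<eta> * of_int m)) * S = - (S - exp (- (2 * \<eta> * of_int m)) * S)"
      using has_sum_uminusI[OF D] by (rule has_sum_unique)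
    then have "S * (1 - exp (- (2 * \<eta> * of_int m))) = 0" by (simp add: algebra_simps)
    with assms False have "S = 0" by auto
    with S False show ?thesis by simp
  qed
qed

section \<open>Theta series and the nonvanishing of the normalising constant\<close>

lemma summable_gauss_exp:
  assumes "\<eta> > 0" "\<And>n. norm (e n) = (1::real)"
  shows "(\<lambda>n::int. norm (of_real (exp (- \<eta> * (of_int n)\<^sup>2)) * (e n :: complex))) summable_on UNIV"
  using summable_on_gauss_int_0[OF assms(1)] by (simp add: norm_mult assms(2))

text \<open>Grouping the product of the series by m = n + k leaves e m times the convolution at m,
  so only m = 0 contributes. A general unimodular character e covers both exp (2 i n z) and
  (-1)^n.\<close>

lemma dual_coeff_theta:
  fixes e :: "int \<Rightarrow> complex"
  assumes "\<eta> > 0" and e: "\<And>m n. e (m + n) = e m * e n" "\<And>n. norm (e n) = 1"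
    and H: "((\<lambda>n. of_real (dual_coeff \<eta> n) * e n) has_sum H) UNIV"
    and T: "((\<lambda>n. of_real (exp (- \<eta> * (of_int n)\<^sup>2)) * e n) has_sum T) UNIV"
  shows "H * T = of_real (dual_norm \<eta>)"
proof -
  have e0: "e 0 = 1" using e(1)[of 0 0] e(2)[of 0] by auto
  have "((\<lambda>(n, k). (of_real (dual_coeff \<eta> n) * e n) * (of_real (exp (- \<eta> * (of_int k)\<^sup>2)) * e k)) has_sum H * T) UNIV"
    using dual_coeff_abs_summable[OF assms(1)] summable_gauss_exp[OF assms(1) e(2)]
    by (intro has_sum_product_UNIV H T) (auto simp: norm_mult e(2))
  then have "((\<lambda>(m, n). of_real (dual_coeff \<eta> n * exp (- \<eta> * (of_int m - of_int n)\<^sup>2)) * e m) has_sum H * T) (UNIV \<times> UNIV)"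
    by (subst has_sum_reindex_bij_witness[of _ "\<lambda>(n, k). (n + k, n)" "\<lambda>(m, n). (n, m - n)" UNIV
        "\<lambda>(n, k). (of_real (dual_coeff \<eta> n) * e n) * (of_real (exp (- \<eta> * (of_int k)\<^sup>2)) * e k)"])
      (auto simp: e(1)[symmetric] mult_ac)
  then have "((\<lambda>m. of_real (if m = 0 then dual_norm \<eta> else 0) * e m) has_sum H * T) UNIV"
  proof (rule has_sum_SigmaD)
    fix m
    show "((\<lambda>n. case (m, n) of (m, n) \<Rightarrow> of_real (dual_coeff \<eta> n * exp (- \<eta> * (of_int m - of_int n)\<^sup>2)) * e m)
        has_sum of_real (if m = 0 then dual_norm \<eta> else 0) * e m) UNIV"
      using has_sum_cmult_left[OF has_sum_of_real[OF dual_coeff_convolution[OF assms(1), of m]], where c = "e m"]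
      by simp
  qed
  moreover have "((\<lambda>m. of_real (if m = 0 then dual_norm \<eta> else 0) * e m) has_sum of_real (dual_norm \<eta>)) UNIV"
    by (rule has_sum_finite_neutralI[of "{0}"]) (auto simp: e0)
  ultimately show ?thesis by (rule has_sum_unique)
qed

text \<open>The classical identity \<open>\<theta>\<^sub>4(q) \<theta>\<^sub>3(q) = \<theta>\<^sub>4(q\<^sup>2)\<^sup>2\<close>: the pairs of opposite parity cancel under
  \<open>(m, n) \<mapsto> (n, m)\<close>, the others are \<open>(u + v, u - v)\<close>.\<close>

lemma theta4_doubling:
  assumes "\<eta> > 0"
    and P: "((\<lambda>n::int. (-1) powi n * exp (- \<eta> * (of_int n)\<^sup>2)) has_sum P) UNIV"
    and T: "((\<lambda>n::int. exp (- \<eta> * (of_int n)\<^sup>2)) has_sum T) UNIV"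
    and Q: "((\<lambda>n::int. (-1) powi n * exp (- (2 * \<eta>) * (of_int n)\<^sup>2)) has_sum Q) UNIV"
  shows "P * T = (Q\<^sup>2 :: real)"
proof -
  let ?f = "\<lambda>(n, m). ((-1) powi n * exp (- \<eta> * (of_int n)\<^sup>2)) * exp (- \<eta> * (of_int m)\<^sup>2) :: real"
  let ?O = "{(n, m). odd (n + m)} :: (int \<times> int) set"
  let ?E = "{(n, m). even (n + m)} :: (int \<times> int) set"
  have abs: "(\<lambda>n::int. norm ((-1) powi n * exp (- \<kappa> * (of_int n)\<^sup>2) :: real)) summable_on UNIV"
    if "\<kappa> > 0" for \<kappa>
    using summable_on_gauss_int_0[OF that] by (simp add: abs_mult power_int_abs)
  have all: "(?f has_sum P * T) UNIV"
    using abs assms(1) summable_on_gauss_int_0[OF assms(1)] by (intro has_sum_product_UNIV P T) auto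
  then obtain R where O: "(?f has_sum R) ?O"
    using summable_on_subset_banach[of ?f UNIV ?O] by (auto simp: summable_on_def)
  have "(?f has_sum R) ?O \<longleftrightarrow> ((\<lambda>x. - ?f x) has_sum R) ?O"
    by (rule has_sum_reindex_bij_witness[of _ prod.swap prod.swap])
      (auto simp: power_int_minus_left add.commute)
  with O have "((\<lambda>x. - ?f x) has_sum R) ?O" by simp
  then have "R = - R" using has_sum_uminusI[OF O] by (rule has_sum_unique)
  then have "R = 0" by simp
  have "((\<lambda>(u, v). ((-1) powi u * exp (- (2 * \<eta>) * (of_int u)\<^sup>2)) * ((-1) powi v * exp (- (2 * \<eta>) * (of_int v)\<^sup>2)) :: real) has_sum Q * Q) UNIV"
    using abs assms(1) by (intro has_sum_product_UNIV Q) auto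
  moreover have "?f ((\<lambda>(u, v). (u + v, u - v)) x) = (case x of (u, v) \<Rightarrow>
      ((-1) powi u * exp (- (2 * \<eta>) * (of_int u)\<^sup>2)) * ((-1) powi v * exp (- (2 * \<eta>) * (of_int v)\<^sup>2)))" for x
    by (cases x) (auto simp: power_int_minus_left exp_add[symmetric] power2_eq_square algebra_simps)
  ultimately have "((\<lambda>x. ?f ((\<lambda>(u, v). (u + v, u - v)) x)) has_sum Q * Q) UNIV" by presburger
  moreover have "bij_betw (\<lambda>(u, v). (u + v, u - v)) UNIV ?E"
  proof (rule bij_betw_imageI)
    have "x \<in> range (\<lambda>(u, v). (u + v, u - v))" if "x \<in> ?E" for x :: "int \<times> int"
    proof -
      obtain n m where x: "x = (n, m)" by (cases x)
      then have "even (n + m)" using \<open>x \<in> ?E\<close> by simp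
      then obtain k where "n + m = 2 * k" by (rule evenE)
      then have "x = (\<lambda>(u, v). (u + v, u - v)) (k, n - k)" using x by auto
      then show ?thesis by blast
    qed
    then show "range (\<lambda>(u, v). (u + v, u - v)) = ?E" by auto
  qed (auto simp: inj_on_def)
  ultimately have E: "(?f has_sum Q * Q) ?E"
    by (simp only: has_sum_reindex_bij_betw)
  have "(?f has_sum R + Q * Q) (?O \<union> ?E)"
    using O E by (rule has_sum_Un_disjoint) auto
  moreover have "?O \<union> ?E = UNIV" by auto
  ultimately show ?thesis
    using all \<open>R = 0\<close> by (auto simp: power2_eq_square dest: has_sum_unique)
qed

text \<open>By P T = Q^2, nonvanishing at 2 \<eta> implies nonvanishing at \<eta>. The induction
  counts the doublings needed to reach \<eta> \<ge> 2, where a direct estimate suffices.\<close>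

lemma theta4_nonzero:
  assumes "\<eta> > 0"
    and "((\<lambda>n::int. (-1) powi n * exp (- \<eta> * (of_int n)\<^sup>2)) has_sum P) UNIV"
  shows "P \<noteq> (0::real)"
proof -
  have *: "P \<noteq> 0"
    if "((\<lambda>n::int. (-1) powi n * exp (- \<eta> * (of_int n)\<^sup>2)) has_sum P) UNIV" "\<eta> * 2 ^ k \<ge> 2"
      "\<eta> > 0" for k \<eta> and P :: real
    using that
  proof (induction k arbitrary: \<eta> P)
    case 0
    define r where "r = exp (- \<eta>)"
    have "exp (- \<eta>) \<le> exp (- 2)" using 0 by simp
    moreover have "exp (2::real) > 3"
      using exp_lower_Taylor_quadratic[of 2] by simp
    then have "exp (- 2 :: real) < 1 / 3" by (simp add: exp_minus field_simps)
    ultimately have r: "r < 1 / 3" "r > 0"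
      unfolding r_def by (linarith, simp)
    \<comment> \<open>A termwise minorant that agrees with the series at n = 0. Its sum 2 - (1 + r)
      / (1 - r) is positive exactly when r < 1/3 (for r < 1), and exp (- 2) < 1/3 explains the
      threshold 2 in the induction.\<close>
    have "((\<lambda>n::int. 2 * (if n = 0 then 1 else 0) - r ^ nat \<bar>n\<bar>) has_sum 2 * 1 - (1 + r) / (1 - r)) UNIV"
      using r by (intro has_sum_diff has_sum_cmult_right has_sum_abs_power_int has_sum_finite_neutralI[of "{0}"]) auto
    then have "2 * 1 - (1 + r) / (1 - r) \<le> P"
    proof (rule has_sum_mono[OF _ 0(1)])
      fix n :: int
      have "exp (- \<eta> * (of_int n)\<^sup>2) \<le> exp (- \<eta> * \<bar>of_int n\<bar>)"
        using 0 of_int_abs_le_square[of n] by simp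
      also have "\<dots> = r ^ nat \<bar>n\<bar>"
        by (simp add: r_def exp_of_nat_mult[symmetric] mult.commute)
      finally have "\<bar>(-1) powi n * exp (- \<eta> * (of_int n)\<^sup>2)\<bar> \<le> r ^ nat \<bar>n\<bar>"
        by (simp add: abs_mult power_int_abs)
      then show "2 * (if n = 0 then 1 else 0) - r ^ nat \<bar>n\<bar> \<le> (-1) powi n * exp (- \<eta> * (of_int n)\<^sup>2)"
        by (cases "n = 0") (auto simp: abs_le_iff)
    qed
    with r show ?case by (auto simp: field_simps)
  next
    case (Suc k)
    obtain T where "((\<lambda>n::int. exp (- \<eta> * (of_int n)\<^sup>2)) has_sum T) UNIV"
      using summable_on_gauss_int_0[OF Suc.prems(3)] by (auto simp: summable_on_def)
    moreover obtain Q where Q: "((\<lambda>n::int. (-1) powi n * exp (- (2 * \<eta>) * (of_int n)\<^sup>2)) has_sum Q) UNIV"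
      using summable_on_gauss_int_0[of "2 * \<eta>"] Suc.prems(3)
        abs_summable_summable[of "\<lambda>n::int. (-1) powi n * exp (- (2 * \<eta>) * (of_int n)\<^sup>2)" UNIV]
      by (auto simp: abs_mult power_int_abs summable_on_def)
    ultimately have "P * T = Q\<^sup>2"
      using theta4_doubling Suc.prems by blast
    moreover have "Q \<noteq> 0" using Suc.IH[OF Q] Suc.prems by simp
    ultimately show ?case by auto
  qed
  obtain k where "2 / \<eta> < 2 ^ k" using real_arch_pow[of 2 "2 / \<eta>"] by auto
  then have "\<eta> * 2 ^ k \<ge> 2" using assms by (simp add: field_simps)
  with * assms show ?thesis by blast
qed

text \<open>Evaluate the product of the two series in \<open>dual_coeff_theta\<close> at \<open>e n = (-1)\<^sup>n\<close>, where every term of the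
  first one is positive.\<close>

lemma dual_norm_nonzero:
  assumes "\<eta> > 0"
  shows "dual_norm \<eta> \<noteq> 0"
proof -
  let ?h = "\<lambda>n. dual_coeff \<eta> n * (-1) powi n"
  have "?h summable_on UNIV"
    using dual_coeff_abs_summable[OF assms] abs_summable_summable[of ?h]
    by (simp add: abs_mult power_int_abs)
  then obtain H where H: "(?h has_sum H) UNIV" by (auto simp: summable_on_def)
  have h: "?h n = exp (\<eta> * (of_int n)\<^sup>2) * alt_tail \<eta> \<bar>of_int n\<bar>" for n
    by (simp add: dual_coeff_def power_int_minus_left)
  have "sum ?h {0} \<le> H"
    using h alt_tail_pos[OF assms] by (intro finite_sum_le_has_sum[OF H]) (auto intro!: less_imp_le)
  with h[of 0] alt_tail_pos[OF assms, of 0] have "H > 0" by simp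
  have abs: "(\<lambda>n::int. norm (exp (- \<eta> * (of_int n)\<^sup>2) * (-1) powi n)) summable_on UNIV"
    using summable_on_gauss_int_0[OF assms] by (simp add: abs_mult power_int_abs)
  obtain P where P: "((\<lambda>n::int. exp (- \<eta> * (of_int n)\<^sup>2) * (-1) powi n) has_sum P) UNIV"
    using abs_summable_summable[OF abs] by (auto simp: summable_on_def)
  then have "P \<noteq> 0" using theta4_nonzero[OF assms, of P] by (simp add: mult.commute)
  have "complex_of_real H * of_real P = of_real (dual_norm \<eta>)"
    using has_sum_of_real[OF H, where ?'a = complex] has_sum_of_real[OF P, where ?'a = complex]
    by (intro dual_coeff_theta[OF assms, of "\<lambda>n. (-1) powi n"]) (auto simp: power_int_add norm_power_int)
  with \<open>H > 0\<close> \<open>P \<noteq> 0\<close> show ?thesis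
    by (metis less_irrefl no_zero_divisors of_real_eq_0_iff)
qed

subsection \<open>Gaussian integrals\<close>

text \<open>The characteristic function of the standard normal law after the substitution t = m + c
  x, with c chosen so that \<kappa> c^2 = 1/2.\<close>

lemma has_bochner_integral_gauss_fourier:
  assumes "\<kappa> > 0"
  shows "has_bochner_integral lborel
    (\<lambda>t. complex_of_real (exp (- \<kappa> * (t - m)\<^sup>2)) * exp (\<i> * complex_of_real (y * t)))
    (complex_of_real (sqrt (pi / \<kappa>) * exp (- y\<^sup>2 / (4 * \<kappa>))) * exp (\<i> * complex_of_real (y * m)))"
proof -
  define c where "c = 1 / sqrt (2 * \<kappa>)"
  have c: "c > 0" "\<kappa> * c\<^sup>2 = 1 / 2" "sqrt (pi / \<kappa>) = c * sqrt (2 * pi)"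
    using assms by (auto simp: c_def power_divide power_mult_distrib real_sqrt_divide real_sqrt_mult)
  let ?f = "\<lambda>x. std_normal_density x *\<^sub>R exp (\<i> * complex_of_real ((y * c) * x))"
  have int: "integrable lborel ?f"
    by (rule Bochner_Integration.integrable_bound[of _ std_normal_density])
      (auto intro: integrable_normal_density)
  have "(LINT x|std_normal_distribution. exp (\<i> * complex_of_real ((y * c) * x))) = integral\<^sup>L lborel ?f"
    by (subst integral_density) (auto simp: normal_density_nonneg)
  then have "integral\<^sup>L lborel ?f = complex_of_real (exp (- (y * c)\<^sup>2 / 2))"
    using fun_cong[OF char_std_normal_distribution, of "y * c"] by (simp add: char_def)
  moreover have "- (y * c)\<^sup>2 / 2 = - y\<^sup>2 / (4 * \<kappa>)"
    using c(2) assms by (simp add: power_mult_distrib field_simps)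
  ultimately have "has_bochner_integral lborel ?f (complex_of_real (exp (- y\<^sup>2 / (4 * \<kappa>))))"
    using int by (simp add: has_bochner_integral_iff)
  then have *: "has_bochner_integral lborel (\<lambda>x. (complex_of_real (sqrt (2 * pi)) * exp (\<i> * complex_of_real (y * m))) * ?f x)
    ((complex_of_real (sqrt (2 * pi)) * exp (\<i> * complex_of_real (y * m))) * complex_of_real (exp (- y\<^sup>2 / (4 * \<kappa>))))"
    by (rule has_bochner_integral_mult_right)
  show ?thesis
  proof (subst lborel_has_bochner_integral_real_affine_iff[of c _ _ m])
    have "complex_of_real (exp (- \<kappa> * (m + c * x - m)\<^sup>2)) * exp (\<i> * complex_of_real (y * (m + c * x)))
      = (complex_of_real (sqrt (2 * pi)) * exp (\<i> * complex_of_real (y * m))) * ?f x" for x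
    proof -
      have 1: "- \<kappa> * (m + c * x - m)\<^sup>2 = - x\<^sup>2 / 2"
        using c(2) by (simp add: power_mult_distrib mult.assoc[symmetric])
      have 2: "exp (\<i> * complex_of_real (y * (m + c * x)))
          = exp (\<i> * complex_of_real (y * m)) * exp (\<i> * complex_of_real ((y * c) * x))"
        by (simp add: exp_add[symmetric] algebra_simps)
      show ?thesis
        unfolding 1 2 by (simp add: std_normal_density_def scaleR_conv_of_real)
    qed
    then show "has_bochner_integral lborel
      (\<lambda>x. complex_of_real (exp (- \<kappa> * (m + c * x - m)\<^sup>2)) * exp (\<i> * complex_of_real (y * (m + c * x))))
      ((complex_of_real (sqrt (pi / \<kappa>) * exp (- y\<^sup>2 / (4 * \<kappa>))) * exp (\<i> * complex_of_real (y * m))) /\<^sub>R \<bar>c\<bar>)"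
      using * c(1) by (simp add: c(3) scaleR_conv_of_real field_simps)
  qed (use c in auto)
qed

lemma has_bochner_integral_gauss:
  assumes "\<kappa> > 0"
  shows "has_bochner_integral lborel (\<lambda>t. exp (- \<kappa> * (t - m)\<^sup>2)) (sqrt (pi / \<kappa>))"
  using has_bochner_integral_gauss_fourier[OF assms, of m 0]
  by (simp add: has_bochner_integral_iff integral_complex_of_real complex_of_real_integrable_eq)

section \<open>Termwise integration and the windowed Gaussian integrand\<close>

text \<open>The index set is enumerated by the naturals (hence infinite and countable), which
  reduces the claim to termwise integration of a sequence. The summable norms of the integrals turn
  the ordered sum back into an unordered one.\<close>

lemma has_sum_lebesgue_integral:
  fixes f :: "'i::countable \<Rightarrow> 'a \<Rightarrow> 'b::{banach, second_countable_topology}"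
  assumes "infinite (UNIV :: 'i set)"
    and int: "\<And>i. integrable M (f i)"
    and abs: "(\<lambda>i. LINT x|M. norm (f i x)) summable_on UNIV"
    and pw: "\<And>x. (\<lambda>i. norm (f i x)) summable_on UNIV"
    and F: "\<And>x. ((\<lambda>i. f i x) has_sum F x) UNIV"
  shows "((\<lambda>i. LINT x|M. f i x) has_sum (LINT x|M. F x)) UNIV"
proof -
  define e :: "nat \<Rightarrow> 'i" where "e = from_nat_into UNIV"
  have e: "bij_betw e UNIV UNIV"
    unfolding e_def using assms(1) by (intro bij_betw_from_nat_into) auto
  have F': "(\<lambda>n. f (e n) x) sums F x" for x
    using F[of x] e by (intro has_sum_imp_sums) (simp add: has_sum_reindex_bij_betw[of e UNIV UNIV "\<lambda>i. f i x"])
  have 1: "summable (\<lambda>n. norm (f (e n) x))" for x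
    using pw[of x] e by (intro summable_on_imp_summable) (simp add: summable_on_reindex_bij_betw[of e UNIV UNIV "\<lambda>i. norm (f i x)"])
  have 2: "summable (\<lambda>n. LINT x|M. norm (f (e n) x))"
    using abs e by (intro summable_on_imp_summable) (simp add: summable_on_reindex_bij_betw[of e UNIV UNIV "\<lambda>i. LINT x|M. norm (f i x)"])
  have "(\<lambda>n. LINT x|M. f (e n) x) sums (LINT x|M. (\<Sum>n. f (e n) x))"
    using 1 2 by (intro sums_integral int) auto
  moreover have "(\<Sum>n. f (e n) x) = F x" for x using F'[of x] by (simp add: sums_iff)
  ultimately have "(\<lambda>n. LINT x|M. f (e n) x) sums (LINT x|M. F x)" by simp
  moreover have "summable (\<lambda>n. norm (LINT x|M. f (e n) x))"
    using 2 by (rule summable_comparison_test'[of _ 0]) auto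
  ultimately have "((\<lambda>n. LINT x|M. f (e n) x) has_sum (LINT x|M. F x)) UNIV"
    by (intro norm_summable_imp_has_sum)
  then show ?thesis
    using e by (simp add: has_sum_reindex_bij_betw[of e UNIV UNIV "\<lambda>i. LINT x|M. f i x"])
qed

lemma summable_on_gauss_lattice:
  assumes "\<kappa> > 0" "\<beta> > 0"
  shows "(\<lambda>k::int. exp (- \<kappa> * (x - \<beta> * of_int k)\<^sup>2) :: real) summable_on UNIV"
proof -
  have "\<beta>\<^sup>2 * (x / \<beta> - of_int k)\<^sup>2 = (x - \<beta> * of_int k)\<^sup>2" for k
    using assms by (simp add: power_mult_distrib[symmetric] algebra_simps)
  then show ?thesis
    using summable_on_gauss_int[of "\<kappa> * \<beta>\<^sup>2" "x / \<beta>"] assms by (simp add: mult.assoc)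
qed

text \<open>The conjugated chirp of the window cancels the quadratic phase of the kernel in t, so
  only a character of frequency (a x - s) / b remains. The two Gaussians merge into one of half the
  variance, centred at the midpoint of u and x.\<close>

lemma chirp_gaussian_window_integrand:
  fixes A :: "real^2^2"
  assumes "\<sigma> > 0" "A $ 1 $ 2 > 0"
  shows "gaussian \<sigma> (t - u) * cnj (chirp_gaussian A \<sigma> (t - x)) * lct_kernel A s t =
    exp (\<i> * complex_of_real (pi / A $ 1 $ 2 * (A $ 2 $ 2 * s\<^sup>2 - A $ 1 $ 1 * x\<^sup>2))) /
      csqrt (\<i> * complex_of_real (A $ 1 $ 2)) *
    complex_of_real (exp (- (x - u)\<^sup>2 / (4 * \<sigma>\<^sup>2))) *
    (complex_of_real (exp (- (1 / \<sigma>\<^sup>2) * (t - (u + x) / 2)\<^sup>2)) *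
      exp (\<i> * complex_of_real (2 * pi * ((A $ 1 $ 1 * x - s) / A $ 1 $ 2) * t)))"
proof -
  define a b d where "a = A $ 1 $ 1" and "b = A $ 1 $ 2" and "d = A $ 2 $ 2"
  have b: "b > 0" using assms by (simp add: b_def)
  have "gaussian \<sigma> (t - u) * gaussian \<sigma> (t - x) = complex_of_real (exp (- (x - u)\<^sup>2 / (4 * \<sigma>\<^sup>2))) *
    complex_of_real (exp (- (1 / \<sigma>\<^sup>2) * (t - (u + x) / 2)\<^sup>2))"
  proof -
    have "- (t - u)\<^sup>2 / (2 * \<sigma>\<^sup>2) + - (t - x)\<^sup>2 / (2 * \<sigma>\<^sup>2)
      = - (x - u)\<^sup>2 / (4 * \<sigma>\<^sup>2) + - (1 / \<sigma>\<^sup>2) * (t - (u + x) / 2)\<^sup>2"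
      using assms(1) by (simp add: field_simps power2_eq_square)
    then show ?thesis by (simp add: gaussian_def exp_add[symmetric] flip: of_real_mult)
  qed
  moreover have "exp (- (\<i> * complex_of_real (pi * (a / b) * (t - x)\<^sup>2))) *
      exp (\<i> * complex_of_real (pi / b * (a * t\<^sup>2 - 2 * s * t + d * s\<^sup>2))) =
    exp (\<i> * complex_of_real (pi / b * (d * s\<^sup>2 - a * x\<^sup>2))) *
      exp (\<i> * complex_of_real (2 * pi * ((a * x - s) / b) * t))"
  proof -
    have "- (pi * (a / b) * (t - x)\<^sup>2) + pi / b * (a * t\<^sup>2 - 2 * s * t + d * s\<^sup>2)
      = pi / b * (d * s\<^sup>2 - a * x\<^sup>2) + 2 * pi * ((a * x - s) / b) * t"
      using b by (simp add: field_simps power2_eq_square)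
    then show ?thesis
      unfolding exp_add[symmetric] mult_minus_right[symmetric] distrib_left[symmetric]
        of_real_minus[symmetric] of_real_add[symmetric] by simp
  qed
  moreover have "cnj (gaussian \<sigma> r) = gaussian \<sigma> r" for r by (simp add: gaussian_def)
  ultimately show ?thesis
    unfolding a_def[symmetric] b_def[symmetric] d_def[symmetric]
    by (simp add: chirp_gaussian_def lct_kernel_def exp_cnj a_def[symmetric] b_def[symmetric] d_def[symmetric]
        mult_ac)
qed

subsection \<open>Expansion of the measurements\<close>

context
  fixes \<sigma> \<beta> :: real and A :: "real^2^2" and c :: "int \<Rightarrow> complex" and f :: "real \<Rightarrow> complex"
  assumes \<sigma>: "\<sigma> > 0" and \<beta>: "\<beta> > 0" and b: "A $ 1 $ 2 > 0"
    and c: "bounded (range c)"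
    and f: "\<And>t. ((\<lambda>k. c k * translate (\<beta> * of_int k) (gaussian \<sigma>) t) has_sum f t) UNIV"
begin

text \<open>The weight is the t-independent factor of the product of the Gaussians centred at
  \<beta> k and x. It turns the merely bounded \<open>c\<close> into an absolutely summable
  sequence.\<close>

definition window_coeff :: "real \<Rightarrow> int \<Rightarrow> complex" where
  "window_coeff x k = c k * complex_of_real (exp (- (x - \<beta> * of_int k)\<^sup>2 / (4 * \<sigma>\<^sup>2)))"

lemma summable_coeff_gauss:
  assumes "\<kappa> > 0"
  shows "(\<lambda>k. norm (c k) * exp (- \<kappa> * (x - \<beta> * of_int k)\<^sup>2)) summable_on UNIV"
proof -
  obtain C where C: "\<And>k. norm (c k) \<le> C" using c by (auto simp: bounded_iff)
  show ?thesis
  proof (rule summable_on_comparison_test)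
    show "(\<lambda>k. C * exp (- \<kappa> * (x - \<beta> * of_int k)\<^sup>2)) summable_on UNIV"
      using assms \<beta> by (intro summable_on_cmult_right summable_on_gauss_lattice)
  qed (auto intro: mult_right_mono C)
qed

lemma summable_window_coeff: "(\<lambda>k. norm (window_coeff x k)) summable_on UNIV"
  using summable_coeff_gauss[of "1 / (4 * \<sigma>\<^sup>2)" x] \<sigma> by (simp add: window_coeff_def norm_mult)

lemma has_sum_stlct:
  fixes x s :: real
  defines "y \<equiv> (A $ 1 $ 1 * x - s) / A $ 1 $ 2"
  shows "((\<lambda>k. exp (\<i> * complex_of_real (pi / A $ 1 $ 2 * (A $ 2 $ 2 * s\<^sup>2 - A $ 1 $ 1 * x\<^sup>2))) /
      csqrt (\<i> * complex_of_real (A $ 1 $ 2)) * complex_of_real (\<sigma> * sqrt pi * exp (- pi\<^sup>2 * \<sigma>\<^sup>2 * y\<^sup>2)) *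
      (window_coeff x k * exp (\<i> * complex_of_real (pi * y * (\<beta> * of_int k + x)))))
    has_sum stlct A (chirp_gaussian A \<sigma>) f x s) UNIV"
proof -
  let ?P = "exp (\<i> * complex_of_real (pi / A $ 1 $ 2 * (A $ 2 $ 2 * s\<^sup>2 - A $ 1 $ 1 * x\<^sup>2))) /
      csqrt (\<i> * complex_of_real (A $ 1 $ 2))"
  let ?W = "window_coeff x"
  let ?\<kappa> = "1 / \<sigma>\<^sup>2"
  define m where "m k = (\<beta> * of_int k + x) / 2" for k :: int
  define g where "g k t = (complex_of_real (exp (- ?\<kappa> * (t - m k)\<^sup>2)) * exp (\<i> * complex_of_real (2 * pi * y * t)))" for k t
  let ?h = "\<lambda>k t. c k * translate (\<beta> * of_int k) (gaussian \<sigma>) t * (cnj (chirp_gaussian A \<sigma> (t - x)) * lct_kernel A s t)"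
  have h: "?h k t = ?P * ?W k * g k t" for k t
    using chirp_gaussian_window_integrand[OF \<sigma> b, of t "\<beta> * of_int k" x s]
    by (simp add: translate_def window_coeff_def g_def m_def y_def mult_ac)
  have G: "has_bochner_integral lborel (g k) (complex_of_real (\<sigma> * sqrt pi * exp (- pi\<^sup>2 * \<sigma>\<^sup>2 * y\<^sup>2)) *
      exp (\<i> * complex_of_real (pi * y * (\<beta> * of_int k + x))))" for k
  proof -
    have "sqrt (pi / ?\<kappa>) = \<sigma> * sqrt pi" using \<sigma> by (simp add: real_sqrt_mult)
    moreover have "- (2 * pi * y)\<^sup>2 / (4 * ?\<kappa>) = - pi\<^sup>2 * \<sigma>\<^sup>2 * y\<^sup>2"
      by (simp add: power_mult_distrib)
    moreover have "2 * pi * y * m k = pi * y * (\<beta> * of_int k + x)" by (simp add: m_def)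
    ultimately show ?thesis
      using has_bochner_integral_gauss_fourier[of ?\<kappa> "m k" "2 * pi * y"] \<sigma>
      by (simp only: g_def[abs_def]) simp
  qed
  have norm_h: "norm (?h k t) = norm ?P * norm (?W k) * exp (- ?\<kappa> * (t - m k)\<^sup>2)" for k t
    unfolding h by (simp only: norm_mult) (simp add: g_def norm_mult)
  have "((\<lambda>k. LINT t|lborel. ?h k t) has_sum
    (LINT t|lborel. f t * (cnj (chirp_gaussian A \<sigma> (t - x)) * lct_kernel A s t))) UNIV"
  proof (rule has_sum_lebesgue_integral)
    show "integrable lborel (?h k)" for k
      unfolding h using G by (intro integrable_mult_right) (auto simp: has_bochner_integral_iff)
    have "(LINT t|lborel. norm (?h k t)) = norm ?P * norm (?W k) * sqrt (pi / ?\<kappa>)" for k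
      unfolding norm_h using has_bochner_integral_gauss[of ?\<kappa> "m k"] \<sigma>
      by (simp add: has_bochner_integral_iff)
    then show "(\<lambda>k. LINT t|lborel. norm (?h k t)) summable_on UNIV"
      using summable_window_coeff by (simp only:) (intro summable_on_cmult_left summable_on_cmult_right)
    show "((\<lambda>k. ?h k t) has_sum f t * (cnj (chirp_gaussian A \<sigma> (t - x)) * lct_kernel A s t)) UNIV" for t
      using f by (rule has_sum_cmult_left)
    have "(\<lambda>k. norm (c k) * exp (- (1 / (2 * \<sigma>\<^sup>2)) * (t - \<beta> * of_int k)\<^sup>2) *
        norm (cnj (chirp_gaussian A \<sigma> (t - x)) * lct_kernel A s t)) summable_on UNIV" for t
      using \<sigma> by (intro summable_on_cmult_left summable_coeff_gauss) auto
    then show "(\<lambda>k. norm (?h k t)) summable_on UNIV" for t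
      by (simp add: norm_mult translate_def gaussian_def)
  qed simp
  moreover have "(LINT t|lborel. ?h k t) = ?P * complex_of_real (\<sigma> * sqrt pi * exp (- pi\<^sup>2 * \<sigma>\<^sup>2 * y\<^sup>2)) *
      (?W k * exp (\<i> * complex_of_real (pi * y * (\<beta> * of_int k + x))))" for k
    unfolding h using G[of k] by (simp add: has_bochner_integral_iff mult_ac)
  ultimately show ?thesis
    by (simp add: stlct_def mult.assoc)
qed

text \<open>In the product of the series with its conjugate the prefactor contributes only its
  squared modulus 1 / b, and the phases in x cancel, so the oscillation depends on k - l
  alone.\<close>

lemma has_sum_stlct_square:
  fixes x s :: real
  defines "y \<equiv> (A $ 1 $ 1 * x - s) / A $ 1 $ 2"
  shows "((\<lambda>(k, l). complex_of_real (pi * \<sigma>\<^sup>2 / A $ 1 $ 2) * (window_coeff x k * cnj (window_coeff x l)) *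
      (complex_of_real (exp (- (2 * pi\<^sup>2 * \<sigma>\<^sup>2) * y\<^sup>2)) *
       exp (\<i> * complex_of_real (pi * y * \<beta> * of_int (k - l)))))
    has_sum complex_of_real ((cmod (stlct A (chirp_gaussian A \<sigma>) f x s))\<^sup>2)) UNIV"
proof -
  let ?S = "stlct A (chirp_gaussian A \<sigma>) f x s"
  let ?P = "exp (\<i> * complex_of_real (pi / A $ 1 $ 2 * (A $ 2 $ 2 * s\<^sup>2 - A $ 1 $ 1 * x\<^sup>2))) /
      csqrt (\<i> * complex_of_real (A $ 1 $ 2))"
  let ?N = "\<sigma> * sqrt pi * exp (- pi\<^sup>2 * \<sigma>\<^sup>2 * y\<^sup>2)"
  let ?e = "\<lambda>k::int. exp (\<i> * complex_of_real (pi * y * (\<beta> * of_int k + x)))"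
  let ?t = "\<lambda>k. ?P * complex_of_real ?N * (window_coeff x k * ?e k)"
  have t: "(?t has_sum ?S) UNIV"
    using has_sum_stlct[where x = x and s = s] by (simp only: y_def)
  have abs: "(\<lambda>k. norm (?t k)) summable_on UNIV"
  proof -
    have "norm (?t k) = norm (?P * complex_of_real ?N) * norm (window_coeff x k)" for k
      by (simp only: norm_mult) simp
    then show ?thesis
      by (simp only:) (intro summable_on_cmult_right summable_window_coeff)
  qed
  have "((\<lambda>(k, l). ?t k * cnj (?t l)) has_sum ?S * cnj ?S) UNIV"
  proof (rule has_sum_product_UNIV[OF abs _ t])
    show "(\<lambda>l. norm (cnj (?t l))) summable_on UNIV" using abs by (simp only: complex_mod_cnj)
    show "((\<lambda>l. cnj (?t l)) has_sum cnj ?S) UNIV" using t by (simp only: has_sum_cnj_iff)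
  qed
  moreover have "?t k * cnj (?t l) = complex_of_real (pi * \<sigma>\<^sup>2 / A $ 1 $ 2) * (window_coeff x k * cnj (window_coeff x l)) *
      (complex_of_real (exp (- (2 * pi\<^sup>2 * \<sigma>\<^sup>2) * y\<^sup>2)) * exp (\<i> * complex_of_real (pi * y * \<beta> * of_int (k - l))))" for k l
  proof -
    have "?P * cnj ?P = complex_of_real ((norm ?P)\<^sup>2)" by (rule complex_norm_square[symmetric])
    also have "(norm ?P)\<^sup>2 = 1 / A $ 1 $ 2"
      using b by (simp add: norm_divide power_divide norm_mult)
    finally have P: "?P * cnj ?P = complex_of_real (1 / A $ 1 $ 2)" .
    have N: "?N * ?N = pi * \<sigma>\<^sup>2 * exp (- (2 * pi\<^sup>2 * \<sigma>\<^sup>2) * y\<^sup>2)"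
    proof -
      have "?N * ?N = (sqrt pi * sqrt pi) * (\<sigma> * \<sigma>) * (exp (- pi\<^sup>2 * \<sigma>\<^sup>2 * y\<^sup>2) * exp (- pi\<^sup>2 * \<sigma>\<^sup>2 * y\<^sup>2))"
        by (simp only: mult_ac)
      also have "exp (- pi\<^sup>2 * \<sigma>\<^sup>2 * y\<^sup>2) * exp (- pi\<^sup>2 * \<sigma>\<^sup>2 * y\<^sup>2) = exp (- (2 * pi\<^sup>2 * \<sigma>\<^sup>2) * y\<^sup>2)"
        unfolding exp_add[symmetric] by simp
      finally show ?thesis by (simp add: power2_eq_square)
    qed
    have e: "?e k * cnj (?e l) = exp (\<i> * complex_of_real (pi * y * \<beta> * of_int (k - l)))"
      by (simp add: exp_cnj exp_add[symmetric] algebra_simps)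
    have "?t k * cnj (?t l) = (?P * cnj ?P) * complex_of_real (?N * ?N) * (window_coeff x k * cnj (window_coeff x l)) * (?e k * cnj (?e l))"
      by (simp only: complex_cnj_mult complex_cnj_complex_of_real of_real_mult mult_ac)
    also have "\<dots> = complex_of_real (1 / A $ 1 $ 2) * complex_of_real (pi * \<sigma>\<^sup>2 * exp (- (2 * pi\<^sup>2 * \<sigma>\<^sup>2) * y\<^sup>2)) *
        (window_coeff x k * cnj (window_coeff x l)) * exp (\<i> * complex_of_real (pi * y * \<beta> * of_int (k - l)))"
      by (simp only: P N e)
    finally show ?thesis by (simp add: mult_ac)
  qed
  moreover have "?S * cnj ?S = complex_of_real ((cmod ?S)\<^sup>2)"
    by (rule complex_norm_square[symmetric])
  ultimately show ?thesis by (simp only:)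
qed

text \<open>In s each term is a Gaussian around a x times a character, and its Fourier integral is a
  Gaussian in \<xi> - \<beta> (k - l) / 2. The phases depending on (k, l) cancel; the common phase
  exp (2 pi i a x \<xi> / b) is the one that the exponential prefactor of the reconstruction formula
  removes at x = \<beta> n / 2.\<close>

lemma has_sum_measurement:
  fixes x \<xi> :: real
  shows "((\<lambda>(k, l). exp (\<i> * complex_of_real (2 * pi * A $ 1 $ 1 * x * \<xi> / A $ 1 $ 2)) *
      complex_of_real (\<sigma> * sqrt (pi / 2)) * (window_coeff x k * cnj (window_coeff x l)) *
      complex_of_real (exp (- (\<xi> - \<beta> * of_int (k - l) / 2)\<^sup>2 / (2 * \<sigma>\<^sup>2))))
    has_sum (LINT s|lborel. complex_of_real ((cmod (stlct A (chirp_gaussian A \<sigma>) f x s))\<^sup>2) *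
      exp (2 * pi * \<i> * complex_of_real (\<xi> * s / A $ 1 $ 2)))) UNIV"
proof -
  define a b where "a = A $ 1 $ 1" and "b = A $ 1 $ 2"
  have b0: "b > 0" using b by (simp add: b_def)
  define \<kappa> where "\<kappa> = 2 * pi\<^sup>2 * \<sigma>\<^sup>2 / b\<^sup>2"
  have \<kappa>: "\<kappa> > 0" using b0 \<sigma> by (simp add: \<kappa>_def)
  let ?W = "\<lambda>k l. window_coeff x k * cnj (window_coeff x l)"
  define \<delta> where "\<delta> k l = \<beta> * of_int (k - l) / 2" for k l :: int
  define C where "C k l = complex_of_real (pi * \<sigma>\<^sup>2 / b) * ?W k l * exp (\<i> * complex_of_real (2 * pi * \<delta> k l * a * x / b))" for k l
  define g where "g k l s = complex_of_real (exp (- \<kappa> * (s - a * x)\<^sup>2)) *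
    exp (\<i> * complex_of_real ((2 * pi * (\<xi> - \<delta> k l) / b) * s))" for k l s
  let ?h = "\<lambda>(k, l) s. C k l * g k l s"
  have abs: "(\<lambda>(k, l). norm (C k l)) summable_on UNIV"
  proof -
    have "(\<lambda>(k, l). norm (window_coeff x k * cnj (window_coeff x l))) summable_on UNIV"
      using summable_window_coeff by (intro summable_on_norm_product) auto
    moreover have "norm (C k l) = norm (complex_of_real (pi * \<sigma>\<^sup>2 / b)) * norm (?W k l)" for k l
      unfolding C_def by (simp only: norm_mult) simp
    ultimately show ?thesis
      using summable_on_cmult_right[of "\<lambda>(k, l). norm (?W k l)" UNIV "norm (complex_of_real (pi * \<sigma>\<^sup>2 / b))"]
      by (simp only: case_prod_unfold)
  qed
  have norm_h: "norm (C k l * g k l s) = norm (C k l) * exp (- \<kappa> * (s - a * x)\<^sup>2)" for k l s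
    by (simp add: norm_mult g_def)
  have G: "has_bochner_integral lborel (g k l)
      (complex_of_real (sqrt (pi / \<kappa>) * exp (- (2 * pi * (\<xi> - \<delta> k l) / b)\<^sup>2 / (4 * \<kappa>))) *
       exp (\<i> * complex_of_real ((2 * pi * (\<xi> - \<delta> k l) / b) * (a * x))))" for k l
    using has_bochner_integral_gauss_fourier[OF \<kappa>, of "a * x" "2 * pi * (\<xi> - \<delta> k l) / b"]
    by (simp only: g_def[abs_def])
  have "((\<lambda>p. LINT s|lborel. ?h p s) has_sum
    (LINT s|lborel. complex_of_real ((cmod (stlct A (chirp_gaussian A \<sigma>) f x s))\<^sup>2) *
      exp (2 * pi * \<i> * complex_of_real (\<xi> * s / b)))) UNIV"
  proof (rule has_sum_lebesgue_integral)
    show "integrable lborel (?h p)" for p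
      using G by (cases p) (auto simp: has_bochner_integral_iff)
    have "(LINT s|lborel. norm (?h p s)) = (case p of (k, l) \<Rightarrow> norm (C k l)) * sqrt (pi / \<kappa>)" for p
      using has_bochner_integral_gauss[OF \<kappa>, of "a * x"]
      by (cases p) (simp add: norm_h has_bochner_integral_iff)
    then show "(\<lambda>p. LINT s|lborel. norm (?h p s)) summable_on UNIV"
      using abs by (simp only:) (intro summable_on_cmult_left)
    show "(\<lambda>p. norm (?h p s)) summable_on UNIV" for s
      using summable_on_cmult_left[OF abs, of "exp (- \<kappa> * (s - a * x)\<^sup>2)"]
      by (simp add: case_prod_unfold norm_h)
    have "complex_of_real (pi * \<sigma>\<^sup>2 / b) * ?W k l *
       (complex_of_real (exp (- (2 * pi\<^sup>2 * \<sigma>\<^sup>2) * ((a * x - s) / b)\<^sup>2)) *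
       exp (\<i> * complex_of_real (pi * ((a * x - s) / b) * \<beta> * of_int (k - l)))) *
       exp (2 * pi * \<i> * complex_of_real (\<xi> * s / b)) = C k l * g k l s" for k l s
    proof -
      have "(2 * pi\<^sup>2 * \<sigma>\<^sup>2) * ((a * x - s) / b)\<^sup>2 = \<kappa> * (s - a * x)\<^sup>2"
        by (simp add: \<kappa>_def power_divide power2_commute)
      moreover have "exp (\<i> * complex_of_real (pi * ((a * x - s) / b) * \<beta> * of_int (k - l))) *
         exp (2 * pi * \<i> * complex_of_real (\<xi> * s / b)) =
        exp (\<i> * complex_of_real (2 * pi * \<delta> k l * a * x / b)) *
         exp (\<i> * complex_of_real ((2 * pi * (\<xi> - \<delta> k l) / b) * s))"
      proof -
        have "pi * ((a * x - s) / b) * \<beta> * of_int (k - l) + 2 * pi * (\<xi> * s / b)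
          = 2 * pi * \<delta> k l * a * x / b + (2 * pi * (\<xi> - \<delta> k l) / b) * s"
          using b0 by (simp add: \<delta>_def field_simps)
        moreover have "2 * pi * \<i> * complex_of_real (\<xi> * s / b) = \<i> * complex_of_real (2 * pi * (\<xi> * s / b))"
          by simp
        ultimately show ?thesis
          by (simp only: exp_add[symmetric] distrib_left[symmetric] of_real_add[symmetric])
      qed
      ultimately show ?thesis
        by (simp add: C_def g_def mult_ac)
    qed
    then show "((\<lambda>p. ?h p s) has_sum complex_of_real ((cmod (stlct A (chirp_gaussian A \<sigma>) f x s))\<^sup>2) *
      exp (2 * pi * \<i> * complex_of_real (\<xi> * s / b))) UNIV" for s
      using has_sum_cmult_left[OF has_sum_stlct_square[where x = x and s = s], of "exp (2 * pi * \<i> * complex_of_real (\<xi> * s / b))"]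
      by (simp only: a_def[symmetric] b_def[symmetric] case_prod_unfold)
  qed (simp add: finite_prod)
  moreover have "(LINT s|lborel. C k l * g k l s) =
      exp (\<i> * complex_of_real (2 * pi * a * x * \<xi> / b)) *
      complex_of_real (\<sigma> * sqrt (pi / 2)) * ?W k l *
      complex_of_real (exp (- (\<xi> - \<delta> k l)\<^sup>2 / (2 * \<sigma>\<^sup>2)))" for k l
  proof -
    have "pi * \<sigma>\<^sup>2 / b * sqrt (pi / \<kappa>) = \<sigma> * sqrt (pi / 2)"
    proof -
      have "sqrt (pi / \<kappa>) = b / (\<sigma> * pi) * sqrt (pi / 2)"
        using b0 \<sigma> by (simp add: \<kappa>_def real_sqrt_divide real_sqrt_mult field_simps)
      then show ?thesis using b0 \<sigma> by (simp add: field_simps power2_eq_square)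
    qed
    moreover have "- (2 * pi * (\<xi> - \<delta> k l) / b)\<^sup>2 / (4 * \<kappa>) = - (\<xi> - \<delta> k l)\<^sup>2 / (2 * \<sigma>\<^sup>2)"
    proof -
      have "- (2 * pi * z / b)\<^sup>2 / (4 * \<kappa>) = - z\<^sup>2 / (2 * \<sigma>\<^sup>2)" for z
        using b0 \<sigma> by (simp add: \<kappa>_def power_divide power_mult_distrib field_simps)
      then show ?thesis .
    qed
    moreover have "exp (\<i> * complex_of_real (2 * pi * \<delta> k l * a * x / b)) *
       exp (\<i> * complex_of_real ((2 * pi * (\<xi> - \<delta> k l) / b) * (a * x)))
      = exp (\<i> * complex_of_real (2 * pi * a * x * \<xi> / b))"
    proof -
      have "2 * pi * \<delta> k l * a * x / b + (2 * pi * (\<xi> - \<delta> k l) / b) * (a * x) = 2 * pi * a * x * \<xi> / b"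
        using b0 by (simp add: field_simps)
      then show ?thesis
        by (simp only: exp_add[symmetric] distrib_left[symmetric] of_real_add[symmetric])
    qed
    moreover have "(LINT s|lborel. C k l * g k l s) = complex_of_real (pi * \<sigma>\<^sup>2 / b * sqrt (pi / \<kappa>)) * ?W k l *
        complex_of_real (exp (- (2 * pi * (\<xi> - \<delta> k l) / b)\<^sup>2 / (4 * \<kappa>))) *
        (exp (\<i> * complex_of_real (2 * pi * \<delta> k l * a * x / b)) *
         exp (\<i> * complex_of_real ((2 * pi * (\<xi> - \<delta> k l) / b) * (a * x))))"
      using G[of k l] by (simp add: has_bochner_integral_iff C_def mult_ac)
    ultimately show ?thesis by (simp only: mult_ac)
  qed
  ultimately show ?thesis
    by (simp add: a_def b_def \<delta>_def case_prod_unfold)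
qed

end

subsection \<open>The dual generator\<close>

lemma has_sum_theta3:
  assumes "\<eta> > 0"
  shows "((\<lambda>n. complex_of_real (exp (- \<eta> * (of_int n)\<^sup>2)) * exp (\<i> * complex_of_real (2 * of_int n * z)))
    has_sum theta3 (complex_of_real z) (complex_of_real (exp (- \<eta>)))) UNIV"
proof -
  have "complex_of_real (exp (- \<eta>)) powi (n\<^sup>2) * exp (2 * of_int n * \<i> * complex_of_real z)
    = complex_of_real (exp (- \<eta> * (of_int n)\<^sup>2)) * exp (\<i> * complex_of_real (2 * of_int n * z))" for n
  proof -
    have "exp (- \<eta>) powi (n\<^sup>2) = exp (- \<eta> * (of_int n)\<^sup>2)"
      using exp_power_int[of "- \<eta>" "n\<^sup>2"] by (simp add: mult.commute)
    then have "complex_of_real (exp (- \<eta>)) powi (n\<^sup>2) = complex_of_real (exp (- \<eta> * (of_int n)\<^sup>2))"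
      by (simp only: of_real_power_int[symmetric])
    then show ?thesis by (simp add: mult_ac)
  qed
  then show ?thesis
    unfolding theta3_def using abs_summable_summable[OF summable_gauss_exp[OF assms]] by simp
qed

text \<open>The product of the coefficient series and \<theta>_3 is the nonzero constant
  \<open>dual_norm\<close>. This also shows that \<theta>_3 has no real zero, so the quotient in
  \<open>dual_symbol\<close> is a genuine one.\<close>

lemma has_sum_inv_theta3:
  assumes "\<eta> > 0"
  shows "((\<lambda>n. complex_of_real (dual_coeff \<eta> n / dual_norm \<eta>) * exp (\<i> * complex_of_real (2 * of_int n * z)))
    has_sum 1 / theta3 (complex_of_real z) (complex_of_real (exp (- \<eta>)))) UNIV"
proof -
  let ?e = "\<lambda>n::int. exp (\<i> * complex_of_real (2 * of_int n * z))"
  have e: "norm (?e n) = 1" for n by simp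
  have "(\<lambda>n. norm (complex_of_real (dual_coeff \<eta> n) * ?e n)) summable_on UNIV"
    using dual_coeff_abs_summable[OF assms] by (simp add: norm_mult)
  from abs_summable_summable[OF this] obtain H
    where H: "((\<lambda>n. complex_of_real (dual_coeff \<eta> n) * ?e n) has_sum H) UNIV"
    unfolding summable_on_def by blast
  have "?e (m + n) = ?e m * ?e n" for m n
    by (simp add: exp_add[symmetric] algebra_simps)
  then have "H * theta3 (complex_of_real z) (complex_of_real (exp (- \<eta>))) = complex_of_real (dual_norm \<eta>)"
    by (intro dual_coeff_theta[OF assms _ e H has_sum_theta3[OF assms]])
  moreover from this dual_norm_nonzero[OF assms]
  have "theta3 (complex_of_real z) (complex_of_real (exp (- \<eta>))) \<noteq> 0" by auto
  ultimately have "inverse (complex_of_real (dual_norm \<eta>)) * H = 1 / theta3 (complex_of_real z) (complex_of_real (exp (- \<eta>)))"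
    using dual_norm_nonzero[OF assms] by (simp add: field_simps)
  then show ?thesis
    using has_sum_cmult_right[OF H, of "inverse (complex_of_real (dual_norm \<eta>))"]
    by (simp add: field_simps)
qed

text \<open>The Fourier series of 1 / \<theta>_3 is multiplied by the Gaussian and inverted
  termwise: the character exp (i pi \<beta> n t) only moves the evaluation point from x to x +
  \<beta> n / 2.\<close>

lemma has_sum_inv_fourier_dual_symbol:
  assumes "\<sigma> > 0" "\<beta> > 0"
  defines "\<eta> \<equiv> \<beta>\<^sup>2 / (8 * \<sigma>\<^sup>2)"
  shows "((\<lambda>n. complex_of_real (dual_coeff \<eta> n / (dual_norm \<eta> * (\<sigma> * sqrt pi)) * exp (- (x + \<beta> * of_int n / 2)\<^sup>2 / \<sigma>\<^sup>2)))
    has_sum inv_fourier (dual_symbol \<sigma> \<beta>) x) UNIV"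
proof -
  have \<eta>: "\<eta> > 0" using assms by simp
  define \<kappa> where "\<kappa> = pi\<^sup>2 * \<sigma>\<^sup>2"
  have \<kappa>: "\<kappa> > 0" using assms by (simp add: \<kappa>_def)
  define C where "C n = complex_of_real (dual_coeff \<eta> n / dual_norm \<eta>)" for n
  define g where "g n t = complex_of_real (exp (- \<kappa> * (t - 0)\<^sup>2)) *
    exp (\<i> * complex_of_real (2 * pi * (x + \<beta> * of_int n / 2) * t))" for n :: int and t
  have absC: "(\<lambda>n. norm (C n)) summable_on UNIV"
  proof -
    have "norm (C n) = norm (dual_coeff \<eta> n) * inverse \<bar>dual_norm \<eta>\<bar>" for n
      unfolding C_def norm_of_real by (simp add: divide_inverse abs_mult)
    then show ?thesis
      by (simp only:) (intro summable_on_cmult_left dual_coeff_abs_summable \<eta>)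
  qed
  have norm_h: "norm (C n * g n t) = norm (C n) * exp (- \<kappa> * (t - 0)\<^sup>2)" for n t
    by (simp add: norm_mult g_def)
  have G: "has_bochner_integral lborel (g n)
      (complex_of_real (exp (- (x + \<beta> * of_int n / 2)\<^sup>2 / \<sigma>\<^sup>2) / (\<sigma> * sqrt pi)))" for n
  proof -
    have "sqrt (pi / \<kappa>) = 1 / (\<sigma> * sqrt pi)"
      using assms(1) by (simp add: \<kappa>_def real_sqrt_divide real_sqrt_mult field_simps)
    moreover have "- (2 * pi * z)\<^sup>2 / (4 * \<kappa>) = - z\<^sup>2 / \<sigma>\<^sup>2" for z
      using assms(1) by (simp add: \<kappa>_def power_mult_distrib)
    ultimately show ?thesis
      using has_bochner_integral_gauss_fourier[OF \<kappa>, of 0 "2 * pi * (x + \<beta> * of_int n / 2)"]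
      unfolding g_def[abs_def] by simp
  qed
  have "((\<lambda>n. LINT t|lborel. C n * g n t) has_sum
    (LINT t|lborel. dual_symbol \<sigma> \<beta> t * exp (2 * pi * \<i> * complex_of_real (x * t)))) UNIV"
  proof (rule has_sum_lebesgue_integral)
    show "integrable lborel (\<lambda>t. C n * g n t)" for n
      using G by (auto simp: has_bochner_integral_iff)
    have "(LINT t|lborel. norm (C n * g n t)) = norm (C n) * sqrt (pi / \<kappa>)" for n
      unfolding norm_h using has_bochner_integral_gauss[OF \<kappa>, of 0]
      by (simp add: has_bochner_integral_iff)
    then show "(\<lambda>n. LINT t|lborel. norm (C n * g n t)) summable_on UNIV"
      using absC by (simp only:) (intro summable_on_cmult_left)
    show "(\<lambda>n. norm (C n * g n t)) summable_on UNIV" for t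
      unfolding norm_h using absC by (intro summable_on_cmult_left)
    show "((\<lambda>n. C n * g n t) has_sum dual_symbol \<sigma> \<beta> t * exp (2 * pi * \<i> * complex_of_real (x * t))) UNIV" for t
    proof -
      let ?E = "complex_of_real (exp (- pi\<^sup>2 * \<sigma>\<^sup>2 * t\<^sup>2)) * exp (2 * pi * \<i> * complex_of_real (x * t))"
      have "exp (\<i> * complex_of_real (2 * of_int n * (\<beta> / 2 * pi * t))) * ?E = g n t" for n
        by (simp add: g_def \<kappa>_def exp_add[symmetric] algebra_simps)
      moreover have "dual_symbol \<sigma> \<beta> t * exp (2 * pi * \<i> * complex_of_real (x * t)) =
          1 / theta3 (complex_of_real (\<beta> / 2 * pi * t)) (complex_of_real (exp (- \<eta>))) * ?E"
        by (simp add: dual_symbol_def \<eta>_def)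
      ultimately show ?thesis
        using has_sum_cmult_left[OF has_sum_inv_theta3[OF \<eta>, of "\<beta> / 2 * pi * t"], of ?E]
        by (simp only: C_def mult.assoc)
    qed
  qed simp
  moreover have "(LINT t|lborel. C n * g n t) = complex_of_real (dual_coeff \<eta> n / (dual_norm \<eta> * (\<sigma> * sqrt pi)) *
      exp (- (x + \<beta> * of_int n / 2)\<^sup>2 / \<sigma>\<^sup>2))" for n
    using G[of n] by (simp add: has_bochner_integral_iff C_def)
  ultimately show ?thesis by (simp add: inv_fourier_def)
qed

lemma summable_on_norm_has_sum:
  fixes f :: "'a \<Rightarrow> 'b \<Rightarrow> 'c :: banach"
  assumes "(\<lambda>(x, y). norm (f x y)) summable_on UNIV" and "\<And>x. (f x has_sum r x) UNIV"
  shows "(\<lambda>x. norm (r x)) summable_on UNIV"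
proof (rule summable_on_comparison_test)
  have *: "(\<lambda>(x, y). norm (f x y)) summable_on (UNIV \<times> UNIV)" using assms(1) by simp
  then have row: "(\<lambda>y. norm (f x y)) summable_on UNIV" for x
    using summable_on_SigmaD1[of "\<lambda>x y. norm (f x y)" UNIV "\<lambda>_. UNIV" x] by simp
  show "(\<lambda>x. \<Sum>\<^sub>\<infinity>y. norm (f x y)) summable_on UNIV"
    using summable_on_SigmaD[OF *] row by simp
  show "norm (r x) \<le> (\<Sum>\<^sub>\<infinity>y. norm (f x y))" for x
    using norm_has_sum_bound[OF has_sum_infsum[OF row] assms(2)] .
qed auto

section \<open>Samples of the dual generator on the half lattice\<close>

context
  fixes \<sigma> \<beta> \<eta> :: real
  assumes \<sigma>: "\<sigma> > 0" and \<beta>: "\<beta> > 0" and eta_eq: "\<eta> = \<beta>\<^sup>2 / (8 * \<sigma>\<^sup>2)"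
begin

lemma eta_pos: "\<eta> > 0"
  using \<sigma> \<beta> by (simp add: eta_eq)

text \<open>For w = v - \<xi> / 2 this is exp (\<xi>^2 / (4 \<sigma>^2)) times the value at v of
  \<phi>_\<xi> shifted by \<beta> i / 2.\<close>

definition lattice_gauss :: "real \<Rightarrow> int \<Rightarrow> real" where
  "lattice_gauss w i = exp (- (w - \<beta> / 2 * of_int i)\<^sup>2 / \<sigma>\<^sup>2)"

lemma summable_lattice_gauss: "lattice_gauss w summable_on UNIV"
  using summable_on_gauss_lattice[of "1 / \<sigma>\<^sup>2" "\<beta> / 2" w] \<sigma> \<beta> by (simp add: lattice_gauss_def[abs_def])

lemma has_sum_inv_fourier_shift:
  "((\<lambda>i. complex_of_real (dual_coeff \<eta> (n - i) / (dual_norm \<eta> * (\<sigma> * sqrt pi)) * lattice_gauss w i))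
    has_sum inv_fourier (dual_symbol \<sigma> \<beta>) (w - \<beta> / 2 * of_int n)) UNIV"
  using has_sum_inv_fourier_dual_symbol[OF \<sigma> \<beta>, of "w - \<beta> / 2 * of_int n"]
  unfolding eta_eq[symmetric]
  by (subst has_sum_reindex_bij_witness[of _ "\<lambda>k. n - k" "\<lambda>i. n - i" UNIV])
    (auto simp: lattice_gauss_def algebra_simps diff_divide_distrib)

lemma summable_dual_coeff_lattice_gauss:
  "(\<lambda>(n, i). norm (dual_coeff \<eta> (n - i) * lattice_gauss w i)) summable_on UNIV"
proof -
  have "(\<lambda>(k, i). norm (dual_coeff \<eta> k * lattice_gauss w i)) summable_on UNIV"
  proof (rule summable_on_norm_product[OF dual_coeff_abs_summable[OF eta_pos]])
    have "norm (lattice_gauss w i) = lattice_gauss w i" for i by (simp add: lattice_gauss_def)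
    then show "(\<lambda>i. norm (lattice_gauss w i)) summable_on UNIV"
      using summable_lattice_gauss by simp
  qed
  then show ?thesis
    by (subst summable_on_reindex_bij_witness[of _ "\<lambda>(k, i). (k + i, i)" "\<lambda>(n, i). (n - i, i)" UNIV
        "\<lambda>(k, i). norm (dual_coeff \<eta> k * lattice_gauss w i)"]) auto
qed

text \<open>The samples are the convolution of two absolutely summable sequences. This is the decay
  that permits summing over n against bounded measurements.\<close>

lemma summable_inv_fourier_shift:
  "(\<lambda>n. norm (inv_fourier (dual_symbol \<sigma> \<beta>) (w - \<beta> / 2 * of_int n))) summable_on UNIV"
proof (rule summable_on_norm_has_sum[OF _ has_sum_inv_fourier_shift])
  show "(\<lambda>(n, i). norm (complex_of_real (dual_coeff \<eta> (n - i) / (dual_norm \<eta> * (\<sigma> * sqrt pi)) * lattice_gauss w i))) summable_on UNIV"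
  proof -
    have "norm (complex_of_real (dual_coeff \<eta> (n - i) / (dual_norm \<eta> * (\<sigma> * sqrt pi)) * lattice_gauss w i))
      = norm (dual_coeff \<eta> (n - i) * lattice_gauss w i) * inverse \<bar>dual_norm \<eta> * (\<sigma> * sqrt pi)\<bar>" for n i
      unfolding norm_of_real by (simp add: abs_mult divide_inverse mult_ac)
    then show ?thesis
      using summable_on_cmult_left[OF summable_dual_coeff_lattice_gauss[of w], of "inverse \<bar>dual_norm \<eta> * (\<sigma> * sqrt pi)\<bar>"]
      by (simp only: case_prod_unfold)
  qed
qed

text \<open>Biorthogonality in pointwise form: up to a constant, q^((n - j)^2) is the Gram matrix of
  the shifts of \<phi>_\<xi>, and applying it to the dual samples recovers the j-th shift
  itself.\<close>

lemma has_sum_gram_inv_fourier: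
  "((\<lambda>n. complex_of_real (exp (- \<eta> * (of_int (n - j))\<^sup>2)) * inv_fourier (dual_symbol \<sigma> \<beta>) (w - \<beta> / 2 * of_int n))
    has_sum complex_of_real (lattice_gauss w j / (\<sigma> * sqrt pi))) UNIV"
proof -
  let ?N = "dual_norm \<eta> * (\<sigma> * sqrt pi)"
  let ?G = "\<lambda>n i. complex_of_real (exp (- \<eta> * (of_int (n - j))\<^sup>2) * (dual_coeff \<eta> (n - i) / ?N * lattice_gauss w i))"
  let ?c = "\<lambda>i. complex_of_real ((if i = j then dual_norm \<eta> else 0) / ?N * lattice_gauss w i)"
  have "(?c has_sum complex_of_real (lattice_gauss w j / (\<sigma> * sqrt pi))) UNIV"
    using dual_norm_nonzero[OF eta_pos] by (intro has_sum_finite_neutralI[of "{j}"]) auto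
  moreover have "((\<lambda>n. complex_of_real (exp (- \<eta> * (of_int (n - j))\<^sup>2)) * inv_fourier (dual_symbol \<sigma> \<beta>) (w - \<beta> / 2 * of_int n))
      has_sum S) UNIV \<longleftrightarrow> (?c has_sum S) UNIV" for S
  proof (rule has_sum_swap_iff)
    show "(?G n has_sum complex_of_real (exp (- \<eta> * (of_int (n - j))\<^sup>2)) * inv_fourier (dual_symbol \<sigma> \<beta>) (w - \<beta> / 2 * of_int n)) UNIV" for n
      unfolding of_real_mult[of "exp (- \<eta> * (of_int (n - j))\<^sup>2)"]
      using has_sum_inv_fourier_shift by (rule has_sum_cmult_right)
    show "((\<lambda>n. ?G n i) has_sum ?c i) UNIV" for i
    proof (rule has_sum_of_real)
      \<comment> \<open>The convolution at m = j - i with its index moved by i, so only the column i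
        = j survives.\<close>
      have "((\<lambda>n. dual_coeff \<eta> (n - i) * exp (- \<eta> * (of_int (n - j))\<^sup>2)) has_sum (if i = j then dual_norm \<eta> else 0)) UNIV"
        using dual_coeff_convolution[OF eta_pos, of "j - i"]
        by (subst has_sum_reindex_bij_witness[of _ "\<lambda>k. k + i" "\<lambda>n. n - i" UNIV
              "\<lambda>k. dual_coeff \<eta> k * exp (- \<eta> * (of_int (j - i) - of_int k)\<^sup>2)"])
          (auto simp: power2_commute)
      from has_sum_cmult_left[OF this, of "lattice_gauss w i / ?N"]
      show "((\<lambda>n. exp (- \<eta> * (of_int (n - j))\<^sup>2) * (dual_coeff \<eta> (n - i) / ?N * lattice_gauss w i))
        has_sum (if i = j then dual_norm \<eta> else 0) / ?N * lattice_gauss w i) UNIV"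
        by (simp add: mult_ac)
    qed
    show "(\<lambda>(n, i). norm (?G n i)) summable_on UNIV"
    proof (rule summable_on_comparison_test)
      show "(\<lambda>x. inverse \<bar>?N\<bar> * (case x of (n, i) \<Rightarrow> norm (dual_coeff \<eta> (n - i) * lattice_gauss w i))) summable_on UNIV"
        by (intro summable_on_cmult_right summable_dual_coeff_lattice_gauss)
      fix x :: "int \<times> int"
      obtain n i where x: "x = (n, i)" by (cases x)
      have "norm (?G n i) = exp (- \<eta> * (of_int (n - j))\<^sup>2) * (inverse \<bar>?N\<bar> * norm (dual_coeff \<eta> (n - i) * lattice_gauss w i))"
        by (simp add: abs_mult divide_inverse mult_ac del: of_real_mult of_real_divide)
      also have "\<dots> \<le> 1 * (inverse \<bar>?N\<bar> * norm (dual_coeff \<eta> (n - i) * lattice_gauss w i))"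
        using eta_pos by (intro mult_right_mono) auto
      finally show "(case x of (n, i) \<Rightarrow> norm (?G n i)) \<le> inverse \<bar>?N\<bar> * (case x of (n, i) \<Rightarrow> norm (dual_coeff \<eta> (n - i) * lattice_gauss w i))"
        by (simp add: x)
    qed auto
  qed
  ultimately show ?thesis by blast
qed

end

subsection \<open>Reconstruction\<close>

text \<open>After exchanging the sum over n with the one over pairs (k, l), each pair leaves a Gram
  sum with j = k + l. It evaluates to the product of the Gaussians at \<beta> k and \<xi> + \<beta>
  l, so the remaining double sum factors.\<close>

lemma has_sum_reconstruction:
  fixes \<sigma> \<beta> \<xi> v :: real and A :: "real^2^2" and f :: "real \<Rightarrow> complex"
  assumes \<sigma>: "\<sigma> > 0" and \<beta>: "\<beta> > 0" and b: "A $ 1 $ 2 > 0"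
    and f: "f \<in> shift_inv_space \<beta> (gaussian \<sigma>)"
  shows "((\<lambda>n::int. exp (- (pi * \<i> * complex_of_real (A $ 1 $ 1 * \<beta> * of_int n * \<xi> / A $ 1 $ 2))) *
      (LINT t|lborel. complex_of_real ((cmod (stlct A (chirp_gaussian A \<sigma>) f (\<beta> * of_int n / 2) t))\<^sup>2) *
         exp (2 * pi * \<i> * complex_of_real (\<xi> * t / A $ 1 $ 2))) *
      translate (\<beta> / 2 * of_int n) (dual_generator \<sigma> \<beta> \<xi>) v)
    has_sum f v * cnj (f (v - \<xi>))) UNIV"
proof -
  obtain c where c: "bounded (range c)"
    and fc: "\<And>t. ((\<lambda>k. c k * translate (\<beta> * of_int k) (gaussian \<sigma>) t) has_sum f t) UNIV"
    using f by (auto simp: shift_inv_space_def)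
  define \<eta> where "\<eta> = \<beta>\<^sup>2 / (8 * \<sigma>\<^sup>2)"
  have \<eta>: "\<eta> > 0" using \<sigma> \<beta> by (simp add: \<eta>_def)
  define q where "q n = exp (- \<eta> * (of_int n)\<^sup>2)" for n :: int
  define K where "K = sqrt 2 * exp (\<xi>\<^sup>2 / (4 * \<sigma>\<^sup>2))"
  define w where "w = v - \<xi> / 2"
  define \<Psi> where "\<Psi> n = inv_fourier (dual_symbol \<sigma> \<beta>) (w - \<beta> / 2 * of_int n)" for n :: int
  \<comment> \<open>The part of the expanded n-th measurement that does not depend on n; n enters
    only through q (n - (k + l)).\<close>
  define D where "D k l = complex_of_real (\<sigma> * sqrt (pi / 2) * q (k - l) * exp (- (\<xi> - \<beta> * of_int (k - l) / 2)\<^sup>2 / (2 * \<sigma>\<^sup>2))) * (c k * cnj (c l))" for k l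
  define M where "M n = exp (- (pi * \<i> * complex_of_real (A $ 1 $ 1 * \<beta> * of_int n * \<xi> / A $ 1 $ 2))) *
      (LINT t|lborel. complex_of_real ((cmod (stlct A (chirp_gaussian A \<sigma>) f (\<beta> * of_int n / 2) t))\<^sup>2) *
         exp (2 * pi * \<i> * complex_of_real (\<xi> * t / A $ 1 $ 2)))" for n :: int
  let ?F = "\<lambda>n (k, l). D k l * complex_of_real (q (n - (k + l))) * (complex_of_real K * \<Psi> n)"
  let ?p = "\<lambda>(k, l). (c k * translate (\<beta> * of_int k) (gaussian \<sigma>) v) * cnj (c l * translate (\<beta> * of_int l) (gaussian \<sigma>) (v - \<xi>))"
  have dual: "translate (\<beta> / 2 * of_int n) (dual_generator \<sigma> \<beta> \<xi>) v = complex_of_real K * \<Psi> n" for n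
    by (simp add: translate_def dual_generator_def K_def \<Psi>_def w_def algebra_simps)
  have M: "((\<lambda>(k, l). D k l * complex_of_real (q (n - (k + l)))) has_sum M n) UNIV" for n
  proof -
    let ?x = "\<beta> * of_int n / 2"
    let ?e = "exp (- (pi * \<i> * complex_of_real (A $ 1 $ 1 * \<beta> * of_int n * \<xi> / A $ 1 $ 2)))"
    have "?e * exp (\<i> * complex_of_real (2 * pi * A $ 1 $ 1 * ?x * \<xi> / A $ 1 $ 2)) = 1"
      by (simp add: exp_add[symmetric] algebra_simps)
    moreover have "window_coeff \<sigma> \<beta> c ?x k * cnj (window_coeff \<sigma> \<beta> c ?x l)
      = complex_of_real (q (k - l) * q (n - (k + l))) * (c k * cnj (c l))" for k l
    proof -
      have "- (?x - \<beta> * of_int k)\<^sup>2 / (4 * \<sigma>\<^sup>2) + - (?x - \<beta> * of_int l)\<^sup>2 / (4 * \<sigma>\<^sup>2)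
        = - \<eta> * (of_int (k - l))\<^sup>2 + - \<eta> * (of_int (n - (k + l)))\<^sup>2"
        using \<sigma> by (simp add: \<eta>_def field_simps power2_eq_square)
      then have "exp (- (?x - \<beta> * of_int k)\<^sup>2 / (4 * \<sigma>\<^sup>2)) * exp (- (?x - \<beta> * of_int l)\<^sup>2 / (4 * \<sigma>\<^sup>2))
        = q (k - l) * q (n - (k + l))"
        unfolding q_def exp_add[symmetric] by (simp only:)
      then show ?thesis
        unfolding window_coeff_def[OF \<sigma> \<beta> b c fc] complex_cnj_mult complex_cnj_complex_of_real
        by (simp only: of_real_mult[symmetric] mult_ac)
    qed
    ultimately have "?e * (exp (\<i> * complex_of_real (2 * pi * A $ 1 $ 1 * ?x * \<xi> / A $ 1 $ 2)) *
        complex_of_real (\<sigma> * sqrt (pi / 2)) * (window_coeff \<sigma> \<beta> c ?x k * cnj (window_coeff \<sigma> \<beta> c ?x l)) *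
        complex_of_real (exp (- (\<xi> - \<beta> * of_int (k - l) / 2)\<^sup>2 / (2 * \<sigma>\<^sup>2))))
      = D k l * complex_of_real (q (n - (k + l)))" for k l
      unfolding mult.assoc[symmetric] by (simp add: D_def mult_ac)
    then show ?thesis
      using has_sum_cmult_right[OF has_sum_measurement[OF \<sigma> \<beta> b c fc, of ?x \<xi>], of ?e]
      by (simp only: M_def case_prod_unfold)
  qed
  have "((\<lambda>n. M n * (complex_of_real K * \<Psi> n)) has_sum S) UNIV \<longleftrightarrow> (?p has_sum S) UNIV" for S
  proof (rule has_sum_swap_iff)
    show "(?F n has_sum M n * (complex_of_real K * \<Psi> n)) UNIV" for n
      using has_sum_cmult_left[OF M] by (simp add: case_prod_unfold)
    show "((\<lambda>n. ?F n p) has_sum ?p p) UNIV" for p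
    proof -
      obtain k l where p: "p = (k, l)" by (cases p)
      let ?r = "lattice_gauss \<sigma> \<beta> w (k + l)"
      have "D k l * complex_of_real K * complex_of_real (?r / (\<sigma> * sqrt pi)) = ?p (k, l)"
      proof -
        \<comment> \<open>All Gaussian factors recombine into the two shifted generators at v and v
          - \<xi>; the factor exp (\<xi>^2 / (4 \<sigma>^2)) of the dual generator balances the
          exponents, and its sqrt 2 cancels the constants.\<close>
        have exponents: "- \<eta> * (of_int (k - l))\<^sup>2 + - (\<xi> - \<beta> * of_int (k - l) / 2)\<^sup>2 / (2 * \<sigma>\<^sup>2) + \<xi>\<^sup>2 / (4 * \<sigma>\<^sup>2)
            + - (w - \<beta> / 2 * of_int (k + l))\<^sup>2 / \<sigma>\<^sup>2
          = - (v - \<beta> * of_int k)\<^sup>2 / (2 * \<sigma>\<^sup>2) + - (v - \<xi> - \<beta> * of_int l)\<^sup>2 / (2 * \<sigma>\<^sup>2)"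
          using \<sigma> by (simp add: \<eta>_def w_def field_simps power2_eq_square)
        have "\<sigma> * sqrt (pi / 2) * sqrt 2 / (\<sigma> * sqrt pi) = 1"
          using \<sigma> by (simp add: real_sqrt_divide)
        then have "\<sigma> * sqrt (pi / 2) * q (k - l) * exp (- (\<xi> - \<beta> * of_int (k - l) / 2)\<^sup>2 / (2 * \<sigma>\<^sup>2)) * K * (?r / (\<sigma> * sqrt pi))
          = q (k - l) * exp (- (\<xi> - \<beta> * of_int (k - l) / 2)\<^sup>2 / (2 * \<sigma>\<^sup>2)) * exp (\<xi>\<^sup>2 / (4 * \<sigma>\<^sup>2)) * ?r"
          using \<sigma> by (simp add: K_def field_simps real_sqrt_divide)
        also have "\<dots> = exp (- (v - \<beta> * of_int k)\<^sup>2 / (2 * \<sigma>\<^sup>2)) * exp (- (v - \<xi> - \<beta> * of_int l)\<^sup>2 / (2 * \<sigma>\<^sup>2))"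
          unfolding q_def lattice_gauss_def[OF \<sigma> \<beta> \<eta>_def] exp_add[symmetric] exponents ..
        finally have real_factor: "\<sigma> * sqrt (pi / 2) * q (k - l) * exp (- (\<xi> - \<beta> * of_int (k - l) / 2)\<^sup>2 / (2 * \<sigma>\<^sup>2)) * K * (?r / (\<sigma> * sqrt pi)) = exp (- (v - \<beta> * of_int k)\<^sup>2 / (2 * \<sigma>\<^sup>2)) * exp (- (v - \<xi> - \<beta> * of_int l)\<^sup>2 / (2 * \<sigma>\<^sup>2))" .
        have "D k l * complex_of_real K * complex_of_real (?r / (\<sigma> * sqrt pi)) = c k * cnj (c l) * complex_of_real (\<sigma> * sqrt (pi / 2) * q (k - l) * exp (- (\<xi> - \<beta> * of_int (k - l) / 2)\<^sup>2 / (2 * \<sigma>\<^sup>2)) * K * (?r / (\<sigma> * sqrt pi)))"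
          by (simp only: D_def of_real_mult mult_ac)
        also have "\<dots> = ?p (k, l)"
          unfolding real_factor by (simp add: translate_def gaussian_def)
        finally show ?thesis .
      qed
      moreover have "((\<lambda>n. (D k l * complex_of_real K) * (complex_of_real (q (n - (k + l))) * \<Psi> n)) has_sum
          (D k l * complex_of_real K) * complex_of_real (?r / (\<sigma> * sqrt pi))) UNIV"
        unfolding q_def \<Psi>_def
        by (intro has_sum_cmult_right has_sum_gram_inv_fourier[OF \<sigma> \<beta> \<eta>_def])
      ultimately show ?thesis by (simp add: p mult_ac)
    qed
    obtain C where C: "\<And>k. norm (c k) \<le> C" using c by (auto simp: bounded_iff)
    have C0: "C \<ge> 0" using C[of 0] norm_ge_zero order_trans by blast
    let ?B = "\<sigma> * sqrt (pi / 2) * (C * C) * K"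
    have q: "norm (q n) = q n" "q n \<ge> 0" for n by (auto simp: q_def)
    have sq: "(\<lambda>n. norm (q n)) summable_on UNIV"
      using summable_on_gauss_int_0[OF \<eta>] unfolding q(1) by (simp add: q_def)
    have "(\<lambda>(a, b). norm (q a * q b)) summable_on UNIV"
      using sq by (intro summable_on_norm_product)
    then have "(\<lambda>(n, a, b). norm (norm (\<Psi> n) * (q a * q b))) summable_on UNIV"
      using summable_inv_fourier_shift[OF \<sigma> \<beta> \<eta>_def, of w]
        summable_on_norm_product[of "\<lambda>n. norm (\<Psi> n)" "\<lambda>(a, b). q a * q b"]
      by (simp add: \<Psi>_def case_prod_unfold)
    \<comment> \<open>Since \<open>c\<close> does not decay, all three directions need their own
      factor: \<Psi> n, q (k - l) and q (n - (k + l)). The change of variables is injective but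
      misses triples of the wrong parity, hence the restriction to its range.\<close>
    then have "(\<lambda>(n, a, b). norm (norm (\<Psi> n) * (q a * q b))) summable_on range (\<lambda>(n, k, l). (n, k - l, n - (k + l)))"
      by (rule summable_on_subset_banach) auto
    moreover have "inj (\<lambda>(n :: int, k, l). (n, k - l, n - (k + l)))" by (auto simp: inj_on_def)
    ultimately have "(\<lambda>(n, k, l). norm (\<Psi> n) * (q (k - l) * q (n - (k + l)))) summable_on UNIV"
      by (simp add: summable_on_reindex o_def case_prod_unfold abs_mult q)
    then have "(\<lambda>x. ?B * (case x of (n, k, l) \<Rightarrow> norm (\<Psi> n) * (q (k - l) * q (n - (k + l))))) summable_on UNIV"
      by (rule summable_on_cmult_right)
    then show "(\<lambda>(n, p). norm (?F n p)) summable_on UNIV"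
    proof (rule summable_on_comparison_test)
      fix x :: "int \<times> int \<times> int"
      obtain n k l where x: "x = (n, k, l)" by (cases x)
      have K: "K \<ge> 0" by (simp add: K_def)
      have "norm (?F n (k, l)) = (\<sigma> * sqrt (pi / 2) * K * (q (k - l) * q (n - (k + l)) * norm (\<Psi> n))) *
          (exp (- (\<xi> - \<beta> * of_int (k - l) / 2)\<^sup>2 / (2 * \<sigma>\<^sup>2)) * (norm (c k) * norm (c l)))"
        using \<sigma> K q by (simp add: D_def norm_mult abs_mult mult_ac)
      also have "\<dots> \<le> (\<sigma> * sqrt (pi / 2) * K * (q (k - l) * q (n - (k + l)) * norm (\<Psi> n))) * (1 * (C * C))"
        using \<sigma> K q C C0 by (intro mult_left_mono mult_mono) auto
      finally show "(case x of (n, p) \<Rightarrow> norm (?F n p)) \<le> ?B * (case x of (n, k, l) \<Rightarrow> norm (\<Psi> n) * (q (k - l) * q (n - (k + l))))"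
        by (simp add: x mult_ac)
    qed auto
  qed
  moreover have "(?p has_sum f v * cnj (f (v - \<xi>))) UNIV"
  proof (rule has_sum_product_UNIV)
    have "(\<lambda>k. norm (c k * translate (\<beta> * of_int k) (gaussian \<sigma>) u)) summable_on UNIV" for u
      using summable_coeff_gauss[OF \<sigma> \<beta> b c fc, of "1 / (2 * \<sigma>\<^sup>2)" u] \<sigma>
      by (simp add: norm_mult translate_def gaussian_def)
    then show "(\<lambda>k. norm (c k * translate (\<beta> * of_int k) (gaussian \<sigma>) v)) summable_on UNIV"
      "(\<lambda>l. norm (cnj (c l * translate (\<beta> * of_int l) (gaussian \<sigma>) (v - \<xi>)))) summable_on UNIV"
      by (auto simp only: complex_mod_cnj)
  qed (use fc in \<open>simp_all only: has_sum_cnj_iff\<close>)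
  ultimately show ?thesis
    by (simp only: M_def dual)
qed

theorem theorem3p3:
  fixes \<sigma> \<beta> a b c d p :: real
    and A :: "real^2^2"
    and f :: "real \<Rightarrow> complex"
  assumes "\<sigma> > 0" and "\<beta> > 0"
    and "A = vector [vector [a, b], vector [c, d]]"
    and "a * d - b * c = 1" and "b > 0"
    and "f \<in> shift_inv_space \<beta> (gaussian \<sigma>)"
    and "f p \<noteq> 0"
  shows
    "(\<forall>g \<in> shift_inv_space \<beta> (gaussian \<sigma>).
        (\<forall>(n::int) (t::real).
           cmod (stlct A (chirp_gaussian A \<sigma>) g (\<beta> * of_int n / 2) t) =
           cmod (stlct A (chirp_gaussian A \<sigma>) f (\<beta> * of_int n / 2) t)) \<longrightarrow>
        (\<exists>\<tau>'::complex. cmod \<tau>' = 1 \<and> (\<forall>x. g x = \<tau>' * f x)))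
     \<and>
     (\<exists>\<tau>::complex. cmod \<tau> = 1 \<and>
        (\<forall>\<xi>::real.
           (\<lambda>n::int.
              exp (- (pi * \<i> * complex_of_real (a * \<beta> * of_int n * \<xi> / b))) *
              (LINT t|lborel.
                 complex_of_real ((cmod (stlct A (chirp_gaussian A \<sigma>) f (\<beta> * of_int n / 2) t))\<^sup>2) *
                 exp (2 * pi * \<i> * complex_of_real (\<xi> * t / b))) *
              translate (\<beta> / 2 * of_int n) (dual_generator \<sigma> \<beta> \<xi>) (p + \<xi>)) summable_on UNIV \<and>
           f (p + \<xi>) =
             \<tau> * complex_of_real (inverse (cmod (f p))) *
             (\<Sum>\<^sub>\<infinity>n::int.
                exp (- (pi * \<i> * complex_of_real (a * \<beta> * of_int n * \<xi> / b))) *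
                (LINT t|lborel.
                   complex_of_real ((cmod (stlct A (chirp_gaussian A \<sigma>) f (\<beta> * of_int n / 2) t))\<^sup>2) *
                   exp (2 * pi * \<i> * complex_of_real (\<xi> * t / b))) *
                translate (\<beta> / 2 * of_int n) (dual_generator \<sigma> \<beta> \<xi>) (p + \<xi>))))
     \<and>
     (\<lambda>n::int.
        complex_of_real
          (LINT t|lborel. (cmod (stlct A (chirp_gaussian A \<sigma>) f (\<beta> * of_int n / 2) t))\<^sup>2) *
        translate (\<beta> / 2 * of_int n) (dual_generator \<sigma> \<beta> 0) p) summable_on UNIV
     \<and>
     complex_of_real (cmod (f p)) =
       csqrt (\<Sum>\<^sub>\<infinity>n::int.
         complex_of_real
           (LINT t|lborel. (cmod (stlct A (chirp_gaussian A \<sigma>) f (\<beta> * of_int n / 2) t))\<^sup>2) *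
         translate (\<beta> / 2 * of_int n) (dual_generator \<sigma> \<beta> 0) p)"
proof -
  let ?V = "shift_inv_space \<beta> (gaussian \<sigma>)"
  define S where "S g \<xi> v n = exp (- (pi * \<i> * complex_of_real (a * \<beta> * of_int n * \<xi> / b))) *
      (LINT t|lborel. complex_of_real ((cmod (stlct A (chirp_gaussian A \<sigma>) g (\<beta> * of_int n / 2) t))\<^sup>2) *
         exp (2 * pi * \<i> * complex_of_real (\<xi> * t / b))) *
      translate (\<beta> / 2 * of_int n) (dual_generator \<sigma> \<beta> \<xi>) v" for g \<xi> v and n :: int
  have A: "A $ 1 $ 1 = a" "A $ 1 $ 2 = b" by (simp_all add: assms(3))
  have S: "(S g \<xi> v has_sum g v * cnj (g (v - \<xi>))) UNIV" if "g \<in> ?V" for g \<xi> v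
    using has_sum_reconstruction[of \<sigma> \<beta> A g \<xi> v] assms(1,2,5) that
    by (simp only: S_def[abs_def] A)
  note f = assms(6,7)
  have "\<exists>\<tau>'. cmod \<tau>' = 1 \<and> (\<forall>x. g x = \<tau>' * f x)"
    if g: "g \<in> ?V" and eq: "\<forall>(n::int) t. cmod (stlct A (chirp_gaussian A \<sigma>) g (\<beta> * of_int n / 2) t) =
           cmod (stlct A (chirp_gaussian A \<sigma>) f (\<beta> * of_int n / 2) t)" for g
  proof -
    have "S g \<xi> v = S f \<xi> v" for \<xi> v using eq by (simp add: S_def fun_eq_iff)
    \<comment> \<open>Equal measurements give identical series, hence equal products at every pair
      of points.\<close>
    then have *: "g v * cnj (g (v - \<xi>)) = f v * cnj (f (v - \<xi>))" for \<xi> v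
      using S[OF g, of \<xi> v] S[OF f(1), of \<xi> v] by (simp add: has_sum_unique)
    have "complex_of_real ((cmod (g p))\<^sup>2) = complex_of_real ((cmod (f p))\<^sup>2)"
      using *[of p 0] by (simp only: complex_norm_square diff_zero)
    then have norm: "cmod (g p) = cmod (f p)" by (simp only: of_real_eq_iff power2_eq_iff_nonneg norm_ge_zero)
    then have "g p \<noteq> 0" using f(2) by auto
    \<comment> \<open>Pairing x with the fixed point p, that is \<xi> = x - p, and dividing by the
      conjugate of g p yields a constant independent of x.\<close>
    have "g x = (cnj (f p) / cnj (g p)) * f x" for x
      using *[of x "x - p"] \<open>g p \<noteq> 0\<close> by (simp add: field_simps)
    moreover have "cmod (cnj (f p) / cnj (g p)) = 1" using norm f(2) by (simp add: norm_divide)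
    ultimately show ?thesis by blast
  qed
  moreover have "\<exists>\<tau>. cmod \<tau> = 1 \<and> (\<forall>\<xi>. S f \<xi> (p + \<xi>) summable_on UNIV \<and>
      f (p + \<xi>) = \<tau> * complex_of_real (inverse (cmod (f p))) * infsum (S f \<xi> (p + \<xi>)) UNIV)"
  proof (intro exI conjI allI)
    \<comment> \<open>This \<tau> is the phase f p / |f p|; the conjugate appears because the series
      sums to f (p + \<xi>) times the conjugate of f p.\<close>
    show "cmod (complex_of_real (cmod (f p)) / cnj (f p)) = 1" using f(2) by (simp add: norm_divide)
    fix \<xi>
    have *: "(S f \<xi> (p + \<xi>) has_sum f (p + \<xi>) * cnj (f p)) UNIV"
      using S[OF f(1), of \<xi> "p + \<xi>"] by simp
    then show "S f \<xi> (p + \<xi>) summable_on UNIV" by (rule has_sum_imp_summable)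
    show "f (p + \<xi>) = complex_of_real (cmod (f p)) / cnj (f p) * complex_of_real (inverse (cmod (f p))) *
        infsum (S f \<xi> (p + \<xi>)) UNIV"
      unfolding infsumI[OF *] using f(2) by (simp add: field_simps)
  qed
  moreover have "((\<lambda>n::int. complex_of_real (LINT t|lborel. (cmod (stlct A (chirp_gaussian A \<sigma>) f (\<beta> * of_int n / 2) t))\<^sup>2) *
      translate (\<beta> / 2 * of_int n) (dual_generator \<sigma> \<beta> 0) p) has_sum complex_of_real ((cmod (f p))\<^sup>2)) UNIV"
    using S[OF f(1), of 0 p] complex_norm_square[of "f p"]
    by (simp add: S_def[abs_def] integral_complex_of_real flip: of_real_power)
  \<comment> \<open>The last series sums to the nonnegative real |f p|^2, on which the principal
    \<open>csqrt\<close> returns |f p|.\<close>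
  ultimately show ?thesis
    unfolding S_def[abs_def] by (auto simp: has_sum_imp_summable infsumI of_real_sqrt[symmetric] simp del: of_real_power)
qed

end
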